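(* All 8 parabolic subalgebras $\mathfrak p\supset\mathfrak b\supset\mathfrak h$ of $so(7)$ are weakly compatible with $i(\mathrm{Lie}\,G_2)$. Furthermore, $\mathfrak p_{(1,0,1)}$, $\mathfrak p_{(0,1,0)}$, $\mathfrak p_{(1,1,1)}$ and $\mathfrak p_{(0,0,0)}$ are compatible with $i(\mathrm{Lie}\,G_2)$, and the remaining 4 parabolic subalgebras of $so(7)$ containing $\mathfrak b$ are not.
   Context: The base field is $\mathbb C$. $so(7)$ has a fixed Cartan subalgebra $\mathfrak h$ and Borel subalgebra $\mathfrak b\supset\mathfrak h$ with simple roots $\eta_1=\varepsilon_1-\varepsilon_2$, $\eta_2=\varepsilon_2-\varepsilon_3$, $\eta_3=\varepsilon_3$ and Chevalley generators $g_{\pm1},g_{\pm2},g_{\pm3}$ for $\pm\eta_1,\pm\eta_2,\pm\eta_3$. $\mathrm{Lie}\,G_2$ is the simple Lie algebra of type $G_2$ with short simple root $\alpha_1$, long simple root $\alpha_2$, and Chevalley generators $\bar g_{\pm1},\bar g_{\pm2}$ for $\pm\alpha_1,\pm\alpha_2$; $\bar{\mathfrak h}$ and $\bar{\mathfrak b}$ are the corresponding Cartan and Borel subalgebras. The embedding $i:\mathrm{Lie}\,G_2\hookrightarrow so(7)$ is determined by $i(\bar g_{\pm2})=g_{\pm2}$, $i(\bar g_{\pm1})=g_{\pm1}+g_{\pm3}$; it satisfies $i(\bar{\mathfrak h})\subset\mathfrak h$ and $i(\bar{\mathfrak b})\subset\mathfrak b$. For $(a_1,a_2,a_3)\in\{0,1\}^3$,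 $\mathfrak p_{(a_1,a_2,a_3)}\supset\mathfrak b$ is the parabolic subalgebra of $so(7)$ for which the simple root $\eta_j$ is a root of the nilradical if $a_j=1$ and a root of the Levi part if $a_j=0$. For a parabolic $\mathfrak p\supset\mathfrak b$ let $\bar{\mathfrak p}:=i^{-1}(i(\mathrm{Lie}\,G_2)\cap\mathfrak p)$, and let $\mathfrak n,\bar{\mathfrak n}$ be the nilradicals of $\mathfrak p,\bar{\mathfrak p}$. $\mathfrak p$ is weakly compatible with $i(\mathrm{Lie}\,G_2)$ if there exists $\bar h\in\bar{\mathfrak h}$ such that $\gamma(i(\bar h))\in\mathbb Q$ for all roots $\gamma$ of $so(7)$, $\alpha(\bar h)>0$ for all $\bar{\mathfrak h}$-weights $\alpha$ of $\bar{\mathfrak n}$, and $\beta(i(\bar h))\ge0$ for all $\mathfrak h$-weights $\beta$ of $\mathfrak n$. $\mathfrak p$ is compatible with $i(\mathrm{Lie}\,G_2)$ (in the sense of T. Kobayashi) if it can be defined by a hyperbolic grading element lying in $i(\bar{\mathfrak h})$: there is $\bar h\in\bar{\mathfrak h}$ such that $\mathrm{ad}\,i(\bar h)$ is diagonalizable on $so(7)$ with real eigenvalues and $\mathfrak p$ is the sum of the eigenspaces with nonnegative eigenvalues. *)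

theory Defs
  imports "HOL-Analysis.Analysis"
begin

section \<open>Lie algebras over the complex numbers\<close>

text \<open>The Lie algebra is a whole type; subalgebras and ideals are sets, so that every notion
  below applies to any Lie subalgebra \<open>S\<close>.\<close>

locale complex_lie_algebra = vector_space scale
  for scale :: "complex \<Rightarrow> 'a::ab_group_add \<Rightarrow> 'a" +
  fixes br :: "'a \<Rightarrow> 'a \<Rightarrow> 'a"
  assumes br_add_left: "br (x + y) z = br x z + br y z"
    and br_add_right: "br x (y + z) = br x y + br x z"
    and br_scale_left: "br (scale c x) y = scale c (br x y)"
    and br_scale_right: "br x (scale c y) = scale c (br x y)"
    and br_self: "br x x = 0"
    and jacobi: "br x (br y z) + br y (br z x) + br z (br x y) = 0"
begin

definition subalgebra :: "'a set \<Rightarrow> bool" where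
  "subalgebra S \<longleftrightarrow> subspace S \<and> (\<forall>x\<in>S. \<forall>y\<in>S. br x y \<in> S)"

definition ideal :: "'a set \<Rightarrow> 'a set \<Rightarrow> bool" where
  "ideal I S \<longleftrightarrow> subspace I \<and> I \<subseteq> S \<and> (\<forall>x\<in>S. \<forall>y\<in>I. br x y \<in> I)"

definition generated_subalgebra :: "'a set \<Rightarrow> 'a set" where
  "generated_subalgebra X = \<Inter>{S. subalgebra S \<and> X \<subseteq> S}"

definition simple :: "'a set \<Rightarrow> bool" where
  "simple S \<longleftrightarrow> subalgebra S \<and> (\<exists>x\<in>S. \<exists>y\<in>S. br x y \<noteq> 0)
     \<and> (\<forall>I. ideal I S \<longrightarrow> I = {0} \<or> I = S)"

fun lower_central :: "'a set \<Rightarrow> nat \<Rightarrow> 'a set" where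
  "lower_central S 0 = S"
| "lower_central S (Suc n) = span {br x y | x y. x \<in> S \<and> y \<in> lower_central S n}"

definition nilpotent :: "'a set \<Rightarrow> bool" where
  "nilpotent S \<longleftrightarrow> (\<exists>n. lower_central S n = {0})"

definition nilradical :: "'a set \<Rightarrow> 'a set" where
  "nilradical S = span (\<Union>{I. ideal I S \<and> nilpotent I})"

text \<open>Functionals on a Cartan subalgebra \<open>H\<close> are represented by functions on the whole
  type, of which only the restriction to \<open>H\<close> matters; linearity on \<open>H\<close> is automatic for a
  weight.\<close>

definition weight :: "'a set \<Rightarrow> 'a set \<Rightarrow> ('a \<Rightarrow> complex) \<Rightarrow> bool" where
  "weight H V \<gamma> \<longleftrightarrow> (\<exists>x\<in>V. x \<noteq> 0 \<and> (\<forall>h\<in>H. br h x = scale (\<gamma> h) x))"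

definition root :: "'a set \<Rightarrow> 'a set \<Rightarrow> ('a \<Rightarrow> complex) \<Rightarrow> bool" where
  "root H S \<gamma> \<longleftrightarrow> weight H S \<gamma> \<and> (\<exists>h\<in>H. \<gamma> h \<noteq> 0)"

text \<open>The Levi part of \<open>p\<close> containing the Cartan subalgebra \<open>H\<close>: the \<open>l\<close> in the
  decomposition of \<open>p\<close> as the direct sum of \<open>l\<close> and its nilradical.\<close>

definition levi_part :: "'a set \<Rightarrow> 'a set \<Rightarrow> 'a set \<Rightarrow> bool" where
  "levi_part H p l \<longleftrightarrow> subalgebra l \<and> H \<subseteq> l \<and> l \<inter> nilradical p = {0}
     \<and> p = {x + y | x y. x \<in> l \<and> y \<in> nilradical p}"

definition eigenspace :: "'a set \<Rightarrow> 'a \<Rightarrow> complex \<Rightarrow> 'a set" where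
  "eigenspace S h c = {x \<in> S. br h x = scale c x}"

definition ad_diagonalizable :: "'a set \<Rightarrow> 'a \<Rightarrow> bool" where
  "ad_diagonalizable S h \<longleftrightarrow> span (\<Union>c. eigenspace S h c) = S"

text \<open>Here \<open>g j\<close> and \<open>g (- j)\<close> belong to the positive and negative \<open>j\<close>-th simple root.
  The Cartan matrix convention is that \<open>A i j\<close> is the value of the \<open>j\<close>-th simple root on
  the \<open>i\<close>-th simple coroot \<open>[g i, g (- i)]\<close>.\<close>

definition chevalley_generators ::
    "'a set \<Rightarrow> int set \<Rightarrow> (int \<Rightarrow> int \<Rightarrow> int) \<Rightarrow> (int \<Rightarrow> 'a) \<Rightarrow> bool" where
  "chevalley_generators S J A g \<longleftrightarrow>
     generated_subalgebra (g ` (J \<union> uminus ` J)) = S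
   \<and> (\<forall>i\<in>J. \<forall>j\<in>J.
        br (br (g i) (g (- i))) (br (g j) (g (- j))) = 0
      \<and> (i \<noteq> j \<longrightarrow> br (g i) (g (- j)) = 0)
      \<and> br (br (g i) (g (- i))) (g j) = scale (of_int (A i j)) (g j)
      \<and> br (br (g i) (g (- i))) (g (- j)) = scale (- of_int (A i j)) (g (- j))
      \<and> (i \<noteq> j \<longrightarrow> (br (g i) ^^ nat (1 - A i j)) (g j) = 0
                 \<and> (br (g (- i)) ^^ nat (1 - A i j)) (g (- j)) = 0))"

end


section \<open>The Lie algebra so(7)\<close>

type_synonym mat7 = "complex^7^7"

definition mscale :: "complex \<Rightarrow> mat7 \<Rightarrow> mat7" where
  "mscale c X = (\<chi> i j. c * X $ i $ j)"

definition commutator :: "mat7 \<Rightarrow> mat7 \<Rightarrow> mat7" where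
  "commutator X Y = X ** Y - Y ** X"

interpretation gl7: complex_lie_algebra mscale commutator
proof unfold_locales
  have m1: "mscale c X ** Y = mscale c (X ** Y)" and m2: "X ** mscale c Y = mscale c (X ** Y)"
    for c X Y
    by (simp_all add: mscale_def matrix_matrix_mult_def vec_eq_iff sum_distrib_left algebra_simps)
  have m3: "mscale c (X - Y) = mscale c X - mscale c Y" for c X Y
    by (simp add: mscale_def vec_eq_iff algebra_simps)
  have dl: "(X - Y) ** Z = X ** Z - Y ** Z" and dr: "Z ** (X - Y) = Z ** X - Z ** Y"
    for X Y Z :: mat7
    by (simp_all add: matrix_matrix_mult_def vec_eq_iff sum_subtractf algebra_simps)
  have ar: "(X + Y) ** Z = X ** Z + Y ** Z" for X Y Z :: mat7
    by (simp add: matrix_matrix_mult_def vec_eq_iff sum.distrib algebra_simps)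
  show "commutator (mscale c X) Y = mscale c (commutator X Y)"
    and "commutator X (mscale c Y) = mscale c (commutator X Y)" for c X Y
    by (simp_all add: commutator_def m1 m2 m3)
  show "commutator (X + Y) Z = commutator X Z + commutator Y Z"
    and "commutator X (Y + Z) = commutator X Y + commutator X Z" for X Y Z
    by (simp_all add: commutator_def matrix_add_ldistrib ar)
  show "commutator X (commutator Y Z) + commutator Y (commutator Z X)
      + commutator Z (commutator X Y) = 0" for X Y Z
    by (simp add: commutator_def dl dr matrix_mul_assoc)
qed (simp_all add: mscale_def commutator_def vec_eq_iff algebra_simps)

text \<open>The split form: \<open>so7\<close> preserves the symmetric bilinear form whose Gram matrix is
  antidiagonal. The elements of the index type \<open>7\<close> are \<open>0, \<dots>, 6\<close>, in this order. The
  diagonal elements of \<open>so7\<close> are those of the form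
  \<open>diag (x1, x2, x3, 0, - x3, - x2, - x1)\<close>, and the \<open>j\<close>-th basic functional is \<open>xj\<close>.\<close>

definition gram :: mat7 where
  "gram = (\<chi> i j. if j = 6 - i then 1 else 0)"

definition so7 :: "mat7 set" where
  "so7 = {X. transpose X ** gram + gram ** X = 0}"

definition cartan :: "mat7 set" where
  "cartan = {X \<in> so7. \<forall>i j. i \<noteq> j \<longrightarrow> X $ i $ j = 0}"

definition borel :: "mat7 set" where
  "borel = {X \<in> so7. \<forall>i j. j < i \<longrightarrow> X $ i $ j = 0}"

definition simple_root :: "int \<Rightarrow> mat7 \<Rightarrow> complex" ("\<eta>") where
  "\<eta> j X = (if j = 1 then X $ 0 $ 0 - X $ 1 $ 1
            else if j = 2 then X $ 1 $ 1 - X $ 2 $ 2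
            else X $ 2 $ 2)"

definition cartan_matrix_B3 :: "int \<Rightarrow> int \<Rightarrow> int" where
  "cartan_matrix_B3 i j =
     (if i = j then 2 else if i = 3 \<and> j = 2 then - 2 else if \<bar>i - j\<bar> = 1 then - 1 else 0)"

text \<open>The first simple root of \<open>G2\<close> is short and the second one is long.\<close>

definition cartan_matrix_G2 :: "int \<Rightarrow> int \<Rightarrow> int" where
  "cartan_matrix_G2 i j = (if i = j then 2 else if i = 1 then - 3 else - 1)"

definition parabolics :: "mat7 set set" where
  "parabolics = {p. gl7.subalgebra p \<and> borel \<subseteq> p \<and> p \<subseteq> so7}"

fun parabolic_marks :: "nat \<times> nat \<times> nat \<Rightarrow> mat7 set \<Rightarrow> bool" where
  "parabolic_marks (a1, a2, a3) p \<longleftrightarrow>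
     (\<forall>(j, a) \<in> {(1, a1), (2, a2), (3, a3)}.
        (a = 1 \<longrightarrow> gl7.weight cartan (gl7.nilradical p) (\<eta> j))
      \<and> (a = 0 \<longrightarrow> (\<exists>l. gl7.levi_part cartan p l \<and> gl7.weight cartan l (\<eta> j))))"

definition parabolic :: "nat \<times> nat \<times> nat \<Rightarrow> mat7 set" where
  "parabolic a = (THE p. p \<in> parabolics \<and> parabolic_marks a p)"


section \<open>The embedding of Lie G2 and compatibility\<close>

locale G2_in_so7 = complex_lie_algebra scale br
  for scale :: "complex \<Rightarrow> 'g::ab_group_add \<Rightarrow> 'g" and br :: "'g \<Rightarrow> 'g \<Rightarrow> 'g" +
  fixes gbar :: "int \<Rightarrow> 'g" and g :: "int \<Rightarrow> mat7" and \<iota> :: "'g \<Rightarrow> mat7"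
  assumes simple_G2: "simple UNIV"
    and chevalley_G2: "chevalley_generators UNIV {1, 2} cartan_matrix_G2 gbar"
    and chevalley_so7: "gl7.chevalley_generators so7 {1, 2, 3} cartan_matrix_B3 g"
    and root_vectors_so7: "\<And>j h. j \<in> {1, 2, 3} \<Longrightarrow> h \<in> cartan \<Longrightarrow>
          commutator h (g j) = mscale (\<eta> j h) (g j)
        \<and> commutator h (g (- j)) = mscale (- \<eta> j h) (g (- j))"
    and linear_iota: "Vector_Spaces.linear scale mscale \<iota>"
    and bracket_iota: "\<And>x y. \<iota> (br x y) = commutator (\<iota> x) (\<iota> y)"
    and inj_iota: "inj \<iota>"
    and iota_2: "\<iota> (gbar 2) = g 2" "\<iota> (gbar (- 2)) = g (- 2)"
    and iota_1: "\<iota> (gbar 1) = g 1 + g 3" "\<iota> (gbar (- 1)) = g (- 1) + g (- 3)"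
begin

definition cartan_bar :: "'g set" where
  "cartan_bar = span {br (gbar j) (gbar (- j)) | j. j \<in> {1, 2}}"

definition bar :: "mat7 set \<Rightarrow> 'g set" where
  "bar p = \<iota> -` (range \<iota> \<inter> p)"

text \<open>Positivity of a complex number is understood to include that it is real.\<close>

definition weakly_compatible :: "mat7 set \<Rightarrow> bool" where
  "weakly_compatible p \<longleftrightarrow> (\<exists>h\<in>cartan_bar.
      (\<forall>\<gamma>. gl7.root cartan so7 \<gamma> \<longrightarrow> \<gamma> (\<iota> h) \<in> \<rat>)
    \<and> (\<forall>\<alpha>. weight cartan_bar (nilradical (bar p)) \<alpha> \<longrightarrow> \<alpha> h \<in> \<real> \<and> Re (\<alpha> h) > 0)
    \<and> (\<forall>\<beta>. gl7.weight cartan (gl7.nilradical p) \<beta> \<longrightarrow> \<beta> (\<iota> h) \<in> \<real> \<and> Re (\<beta> (\<iota> h)) \<ge> 0))"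

definition compatible :: "mat7 set \<Rightarrow> bool" where
  "compatible p \<longleftrightarrow> (\<exists>h\<in>cartan_bar.
      gl7.ad_diagonalizable so7 (\<iota> h)
    \<and> (\<forall>c. gl7.eigenspace so7 (\<iota> h) c \<noteq> {0} \<longrightarrow> c \<in> \<real>)
    \<and> p = gl7.span (\<Union>c\<in>{c \<in> \<real>. Re c \<ge> 0}. gl7.eigenspace so7 (\<iota> h) c))"

end

end

(* Every parabolic subalgebra containing the Borel subalgebra is the sum of the nonnegative
   eigenspaces of the diagonal element h with \<eta> j (h) = a_j, because it is stable under a regular
   diagonal element. The image of the Cartan subalgebra of G2 is the plane \<eta> 1 = \<eta> 3, so the
   parabolic is compatible exactly when a_1 = a_3: the root vectors for the negatives of \<eta> 1 and
   \<eta> 3 have the same eigenvalue under every element of that plane. Weak compatibility is witnessed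
   by the element with \<eta> 1 = \<eta> 3 = max a_1 a_3 and \<eta> 2 = a_2. The weights of the nilradicals
   are controlled by the fact that an element of a nilpotent ideal is ad-nilpotent, so that a
   diagonal one is zero. *)
theory Submission
  imports Defs
begin

section \<open>The split form of so(7) in matrix entries\<close>

text \<open>A root of so(7) is handled as a matrix entry (i, j) together with its mirror image (6 -
  j, 6 - i), to which a diagonal element with integer weights w assigns the degree w i - w j. A
  parabolic subalgebra and its nilradical become the matrices of degree at least 0 and at least 1.
  The obstacle is that a nilradical is the span of all nilpotent ideals and that
  \<open>bar p\<close> is only a preimage. The nilradical of \<open>bar p\<close> is therefore never
  computed: enclosing every nilpotent ideal in degree at least 1 for a suitable w already makes all
  weights positive. The maximum in the witness arises because \<iota> sends
  \<open>gbar (- 1)\<close> to the sum of \<open>g (- 1)\<close> and \<open>g (- 3)\<close>, which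
  lies in p only if both summands do. So the short simple root can belong to the Levi part of
  \<open>bar p\<close> only if both outer marks are 0, and has to be positive as soon as one of them
  is 1.\<close>

lemma exhaust_7:
  fixes x :: 7
  shows "x = 0 \<or> x = 1 \<or> x = 2 \<or> x = 3 \<or> x = 4 \<or> x = 5 \<or> x = 6"
proof (induct x)
  case (of_int z)
  then have "0 \<le> z" and "z < 7" by simp_all
  then have "z = 0 \<or> z = 1 \<or> z = 2 \<or> z = 3 \<or> z = 4 \<or> z = 5 \<or> z = 6" by arith
  then show ?case by auto
qed

lemma forall_7: "(\<forall>i::7. P i) \<longleftrightarrow> P 0 \<and> P 1 \<and> P 2 \<and> P 3 \<and> P 4 \<and> P 5 \<and> P 6"
  by (metis exhaust_7)

text \<open>The diagonal of an integral element of the Cartan subalgebra, that is, the weights of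
  the seven basis vectors. Integer values let simplification settle the case distinctions over
  indices.\<close>

definition wt :: "int \<Rightarrow> int \<Rightarrow> int \<Rightarrow> 7 \<Rightarrow> int" where
  "wt x y z i = (if i = 0 then x else if i = 1 then y else if i = 2 then z else if i = 3 then 0
     else if i = 4 then - z else if i = 5 then - y else - x)"

lemma wt_simps [simp]:
  "wt x y z 0 = x" "wt x y z 1 = y" "wt x y z 2 = z" "wt x y z 3 = 0"
  "wt x y z 4 = - z" "wt x y z 5 = - y" "wt x y z 6 = - x"
  by (simp_all add: wt_def)

lemma wt_reflect [simp]: "wt x y z (6 - i) = - wt x y z i"
proof -
  have "\<forall>i. wt x y z (6 - i) = - wt x y z i"
    unfolding forall_7 by simp
  then show ?thesis by blast
qed

text \<open>The weights 3, 2, 1, 0, -1, -2, -3 decrease strictly along the indices, so the order of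
  the type \<open>7\<close> turns into integer arithmetic.\<close>

lemma less_iff_wt: "i < j \<longleftrightarrow> wt 3 2 1 j < wt 3 2 1 i"
proof -
  have "\<forall>i j :: 7. i < j \<longleftrightarrow> wt 3 2 1 j < wt 3 2 1 i"
    unfolding forall_7 by (simp add: less_bit1_def bit1.Rep_numeral bit1.Rep_0 bit1.Rep_1)
  then show ?thesis by blast
qed

lemma wt_antimono:
  assumes "x \<ge> y" "y \<ge> z" "z \<ge> 0" "i \<le> j"
  shows "wt x y z j \<le> wt x y z i"
proof -
  have "\<forall>i j :: 7. i < j \<longrightarrow> wt x y z j \<le> wt x y z i"
    unfolding forall_7 less_iff_wt wt_simps using assms(1-3) by simp
  with assms(4) show ?thesis by (cases "i = j") auto
qed

text \<open>The constants are chosen so that no two roots, nor a root and some \<open>2 xi\<close>, take the same value.\<close>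

abbreviation generic :: "7 \<Rightarrow> int" where
  "generic \<equiv> wt 16 5 2"

lemma generic_inj: "generic i = generic j \<longleftrightarrow> i = j"
proof -
  have "\<forall>i j. generic i = generic j \<longleftrightarrow> i = j"
    unfolding forall_7 by simp
  then show ?thesis by blast
qed

text \<open>Root spaces are one-dimensional: a root occupies one entry and its mirror image in the
  antidiagonal, and \<open>generic\<close> separates the roots.\<close>

lemma generic_diff:
  assumes "i \<noteq> j" "generic k - generic l = generic i - generic j"
  shows "k = i \<and> l = j \<or> k = 6 - j \<and> l = 6 - i"
proof -
  have "\<forall>i j k l :: 7. generic i \<noteq> generic j \<longrightarrow> generic k - generic l = generic i - generic j \<longrightarrow>
     generic k = generic i \<and> generic l = generic j \<or> generic k = - generic j \<and> generic l = - generic i"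
    unfolding forall_7 wt_simps by (simp cong: imp_cong)
  with assms have "generic k = generic i \<and> generic l = generic j \<or>
      generic k = generic (6 - j) \<and> generic l = generic (6 - i)"
    unfolding wt_reflect generic_inj[symmetric] by blast
  then show ?thesis unfolding generic_inj .
qed

lemma so7_iff: "X \<in> so7 \<longleftrightarrow> (\<forall>i j. X $ (6 - j) $ (6 - i) = - X $ i $ j)"
proof -
  have reflect: "i = 6 - j \<longleftrightarrow> j = 6 - i" for i j :: 7 by auto
  have "(transpose X ** gram + gram ** X) $ i $ j = X $ (6 - j) $ i + X $ (6 - i) $ j" for i j
    by (simp add: matrix_matrix_mult_def transpose_def gram_def reflect[of j]
        if_distrib[of "\<lambda>x. _ * x"] if_distrib[of "\<lambda>x. x * _"] cong: if_cong)
  then have "X \<in> so7 \<longleftrightarrow> (\<forall>i j. X $ (6 - j) $ i + X $ (6 - i) $ j = 0)"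
    by (simp add: so7_def vec_eq_iff)
  also have "\<dots> \<longleftrightarrow> (\<forall>i j. X $ (6 - j) $ (6 - i) = - X $ i $ j)"
  proof (intro iffI allI)
    fix i j
    assume "\<forall>i j. X $ (6 - j) $ i + X $ (6 - i) $ j = 0"
    from spec[OF spec[OF this, of j], of "6 - i"] show "X $ (6 - j) $ (6 - i) = - X $ i $ j"
      by (simp add: add_eq_0_iff)
  next
    fix i j
    assume "\<forall>i j. X $ (6 - j) $ (6 - i) = - X $ i $ j"
    from spec[OF spec[OF this, of "6 - i"], of j] show "X $ (6 - j) $ i + X $ (6 - i) $ j = 0"
      by simp
  qed
  finally show ?thesis .
qed

lemma so7_reflect: "X \<in> so7 \<Longrightarrow> X $ (6 - j) $ (6 - i) = - X $ i $ j"
  by (simp add: so7_iff)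

lemma so7_antidiagonal: "X \<in> so7 \<Longrightarrow> X $ i $ (6 - i) = 0"
  using so7_reflect[of X "6 - i" i] by simp

text \<open>The root vector at the entry (a, b), made skew with respect to the antidiagonal. It is
  zero for \<open>b = 6 - a\<close>, which is why that case is excluded in many places; for
  \<open>a = b\<close> it is diagonal.\<close>

definition unit7 :: "7 \<Rightarrow> 7 \<Rightarrow> mat7" where
  "unit7 a b = (\<chi> i j. (if i = a \<and> j = b then 1 else 0) - (if i = 6 - b \<and> j = 6 - a then 1 else 0))"

lemma unit7_so7: "unit7 a b \<in> so7"
proof -
  have "(6::7) - i = j \<longleftrightarrow> i = 6 - j" for i j by auto
  then show ?thesis by (simp add: so7_iff unit7_def conj_commute)
qed

lemma commutator_unit7: "commutator X (unit7 a b) $ i $ j =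
    (if j = b then X $ i $ a else 0) - (if j = 6 - a then X $ i $ (6 - b) else 0)
  - (if i = a then X $ b $ j else 0) + (if i = 6 - b then X $ (6 - a) $ j else 0)"
proof -
  have "(X ** unit7 a b) $ i $ j = (if j = b then X $ i $ a else 0) - (if j = 6 - a then X $ i $ (6 - b) else 0)"
    by (simp add: matrix_matrix_mult_def unit7_def right_diff_distrib sum_subtractf
        if_distrib[of "\<lambda>x. _ * x"] conj_commute if_if_eq_conj[symmetric] cong: if_cong)
  moreover have "(unit7 a b ** X) $ i $ j = (if i = a then X $ b $ j else 0) - (if i = 6 - b then X $ (6 - a) $ j else 0)"
    by (simp add: matrix_matrix_mult_def unit7_def left_diff_distrib sum_subtractf
        if_distrib[of "\<lambda>x. x * _"]  if_if_eq_conj[symmetric] cong: if_cong)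
  ultimately show ?thesis by (simp add: commutator_def)
qed

lemma commutator_diagonal:
  assumes "\<And>i j. i \<noteq> j \<Longrightarrow> D $ i $ j = 0"
  shows "commutator D X $ i $ j = (D $ i $ i - D $ j $ j) * X $ i $ j"
proof -
  have D: "D $ i $ j = (if j = i then D $ i $ i else 0)" for i j using assms by auto
  have "(D ** X) $ i $ j = D $ i $ i * X $ i $ j"
    unfolding matrix_matrix_mult_def
    by simp (subst D, simp add: if_distrib[of "\<lambda>x. x * _"] cong: if_cong)
  moreover have D': "D $ i $ j = (if i = j then D $ j $ j else 0)" for i j using assms by auto
  have "(X ** D) $ i $ j = D $ j $ j * X $ i $ j"
    unfolding matrix_matrix_mult_def
    by simp (subst D', simp add: if_distrib[of "\<lambda>x. _ * x"] mult.commute cong: if_cong)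
  ultimately show ?thesis by (simp add: commutator_def algebra_simps)
qed

section \<open>Gradings and nilradicals\<close>

lemma matrix_entry_simps [simp]:
  "(X + Y :: mat7) $ i $ j = X $ i $ j + Y $ i $ j"
  "mscale c X $ i $ j = c * X $ i $ j"
  by (simp_all add: mscale_def)

lemma so7_subspace: "gl7.subspace so7"
  by (auto simp: gl7.subspace_def so7_iff)

lemma so7_commutator:
  assumes "X \<in> so7" "Y \<in> so7"
  shows "commutator X Y \<in> so7"
proof -
  have reflect: "(A ** B) $ (6 - j) $ (6 - i) = (B ** A) $ i $ j"
    if "A \<in> so7" "B \<in> so7" for A B :: mat7 and i j
  proof -
    have "(A ** B) $ (6 - j) $ (6 - i) = (\<Sum>k\<in>UNIV. A $ (6 - j) $ (6 - k) * B $ (6 - k) $ (6 - i))"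
      unfolding matrix_matrix_mult_def
      by (simp, rule sum.reindex_bij_witness[where i = "\<lambda>k. 6 - k" and j = "\<lambda>k. 6 - k"]) auto
    also have "\<dots> = (B ** A) $ i $ j"
      by (simp add: matrix_matrix_mult_def so7_reflect that mult.commute)
    finally show ?thesis .
  qed
  show ?thesis
    unfolding so7_iff commutator_def by (simp add: reflect assms)
qed

lemma unit7_reflect: "unit7 (6 - b) (6 - a) = - unit7 a b"
  by (simp add: unit7_def vec_eq_iff)

lemma unit7_entry: "b \<noteq> 6 - a \<Longrightarrow> unit7 a b $ a $ b = 1"
  by (simp add: unit7_def)

lemma unit7_eq_0: "\<not> (i = a \<and> j = b) \<Longrightarrow> \<not> (i = 6 - b \<and> j = 6 - a) \<Longrightarrow> unit7 a b $ i $ j = 0"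
  by (simp only: unit7_def vec_lambda_beta if_False diff_self)

text \<open>An element of \<open>so7\<close> is a combination of root vectors with its entries as
  coefficients. Summing over all (i, j) meets each entry a second time through its mirror image,
  hence the factor 1/2.\<close>

lemma so7_mem_by_units:
  assumes "gl7.subspace V" "X \<in> so7" "\<And>i j. X $ i $ j \<noteq> 0 \<Longrightarrow> unit7 i j \<in> V"
  shows "X \<in> V"
proof -
  have reflect: "(k = 6 - j \<and> l = 6 - i) = (i = 6 - l \<and> j = 6 - k)" for i j k l :: 7 by auto
  have sum_if: "(\<Sum>j\<in>UNIV. if P then f j else 0) = (if P then \<Sum>j\<in>UNIV. f j else 0)"
    for P and f :: "7 \<Rightarrow> complex" by simp
  have "X = mscale (1/2) (\<Sum>i\<in>UNIV. \<Sum>j\<in>UNIV. mscale (X $ i $ j) (unit7 i j))"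
  proof -
    have "(\<Sum>i\<in>UNIV. \<Sum>j\<in>UNIV. X $ i $ j * unit7 i j $ k $ l) = X $ k $ l - X $ (6 - l) $ (6 - k)" for k l
      unfolding unit7_def
      by (simp add: reflect right_diff_distrib sum_subtractf if_distrib[of "\<lambda>x. _ * x"]
         if_if_eq_conj[symmetric] sum_if eq_commute[of k] eq_commute[of l] cong: if_cong)
    also have "\<dots> k l = 2 * X $ k $ l" for k l
      using so7_reflect[OF assms(2)] by simp
    finally show ?thesis by (simp add: vec_eq_iff)
  qed
  moreover have "mscale (X $ i $ j) (unit7 i j) \<in> V" for i j
    using assms by (cases "X $ i $ j = 0") (auto intro: gl7.subspace_scale gl7.subspace_0)
  ultimately show ?thesis
    by (metis (no_types, lifting) assms(1) gl7.subspace_scale gl7.subspace_sum)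
qed

section \<open>Eigenspaces of integral diagonal elements\<close>

definition dg :: "(7 \<Rightarrow> int) \<Rightarrow> mat7" where
  "dg w = (\<chi> i j. if i = j then of_int (w i) else 0)"

lemma dg_cartan: "dg (wt x y z) \<in> cartan"
  by (auto simp: cartan_def so7_iff dg_def)

lemma commutator_dg: "commutator (dg w) X $ i $ j = of_int (w i - w j) * X $ i $ j"
  by (subst commutator_diagonal) (simp_all add: dg_def)

lemma commutator_cartan:
  "h \<in> cartan \<Longrightarrow> commutator h X $ i $ j = (h $ i $ i - h $ j $ j) * X $ i $ j"
  by (rule commutator_diagonal) (simp add: cartan_def)

lemma cartan_reflect: "h \<in> cartan \<Longrightarrow> h $ (6 - i) $ (6 - i) = - h $ i $ i"
  by (simp add: cartan_def so7_reflect)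

lemma commutator_cartan_unit7:
  assumes "h \<in> cartan"
  shows "commutator h (unit7 a b) = mscale (h $ a $ a - h $ b $ b) (unit7 a b)"
  using cartan_reflect[OF assms]
  by (auto simp: vec_eq_iff commutator_cartan[OF assms] unit7_def)

text \<open>The projection to an eigenspace of \<open>ad (dg w)\<close> is a Lagrange interpolation polynomial in it.\<close>

lemma isotypic_component:
  assumes "gl7.subspace V" "\<And>X. X \<in> V \<Longrightarrow> commutator (dg w) X \<in> V" "X \<in> V"
  shows "(\<chi> i j. if w i - w j = c then X $ i $ j else 0) \<in> V"
proof -
  have "(\<chi> i j. (\<Prod>c'\<in>S. (of_int (w i - w j) - of_int c') / (of_int c - of_int c')) * X $ i $ j) \<in> V"
    if "finite S" "c \<notin> S" for S
    using that
  proof (induction S rule: finite_induct)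
    case empty
    have "(\<chi> i j. X $ i $ j) = X" by (simp add: vec_eq_iff)
    with assms(3) show ?case by simp
  next
    case (insert d S)
    define Y where "Y = (\<chi> i j. (\<Prod>c'\<in>S. (of_int (w i - w j) - of_int c') / (of_int c - of_int c')) * X $ i $ j)"
    have Y: "Y \<in> V" using insert by (simp add: Y_def)
    have "(\<chi> i j. (\<Prod>c'\<in>insert d S. (of_int (w i - w j) - of_int c') / (of_int c - of_int c')) * X $ i $ j)
      = mscale (1 / (of_int c - of_int d)) (commutator (dg w) Y - mscale (of_int d) Y)"
      using insert(1,2)
      by (simp add: vec_eq_iff commutator_dg Y_def del: of_int_diff) (simp add: field_simps del: of_int_diff)
    also have "\<dots> \<in> V"
      by (intro gl7.subspace_scale[OF assms(1)] gl7.subspace_diff[OF assms(1)] assms(2) Y)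
    finally show ?case .
  qed
  \<comment> \<open>All differences other than c: the interpolation polynomial is then 1 at c and 0
    at every other eigenvalue.\<close>
  from this[of "range (\<lambda>(i, j). w i - w j) - {c}"]
  have "(\<chi> i j. (\<Prod>c'\<in>range (\<lambda>(i, j). w i - w j) - {c}.
      (of_int (w i - w j) - of_int c') / (of_int c - of_int c')) * X $ i $ j) \<in> V" by simp
  moreover have "(\<Prod>c'\<in>range (\<lambda>(i, j). w i - w j) - {c}.
      (of_int (w i - w j) - of_int c') / (of_int c - of_int c')) = (if w i - w j = c then 1 else 0 :: complex)"
    for i j
  proof (cases "w i - w j = c")
    case True
    then show ?thesis by (auto intro!: prod.neutral simp del: of_int_diff)
  next
    case False
    then have "w i - w j \<in> range (\<lambda>(i, j). w i - w j) - {c}" by auto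
    with False show ?thesis by (simp del: of_int_diff)
  qed
  ultimately show ?thesis by (simp add: if_distrib[of "\<lambda>x. x * _"] cong: if_cong)
qed

text \<open>By \<open>generic_diff\<close> only the entry (i, j) and its mirror image can be
  nonzero. On the antidiagonal both sides are zero, because twice a basic functional is not a root
  of so(7).\<close>

lemma weight_vector_unit7:
  assumes "X \<in> so7" "i \<noteq> j"
    and "commutator (dg generic) X = mscale (of_int (generic i - generic j)) X"
  shows "X = mscale (X $ i $ j) (unit7 i j)"
proof -
  have zero: "X $ k $ l = 0" if "\<not> (k = i \<and> l = j \<or> k = 6 - j \<and> l = 6 - i)" for k l
  proof -
    have "of_int (generic k - generic l) * X $ k $ l = of_int (generic i - generic j) * X $ k $ l"
      using assms(3) by (metis commutator_dg matrix_entry_simps(2))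
    moreover have "generic k - generic l \<noteq> generic i - generic j"
      using generic_diff assms(2) that by blast
    then have "(of_int (generic k - generic l) :: complex) \<noteq> of_int (generic i - generic j)"
      by (simp only: of_int_eq_iff not_False_eq_True)
    ultimately show ?thesis by simp
  qed
  have "X $ k $ l = X $ i $ j * unit7 i j $ k $ l" for k l
  proof (cases "j = 6 - i")
    case True
    then have "X $ k $ l = 0"
      using zero[of k l] so7_antidiagonal[OF assms(1), of i] by force
    with True so7_antidiagonal[OF assms(1), of i] show ?thesis by simp
  next
    case False
    consider "k = i \<and> l = j" | "k = 6 - j \<and> l = 6 - i"
      | "\<not> (k = i \<and> l = j \<or> k = 6 - j \<and> l = 6 - i)" by blast
    then show ?thesis
    proof cases
      case 1
      then show ?thesis using False by (simp add: unit7_entry)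
    next
      case 2
      then show ?thesis
        using False by (simp add: so7_reflect[OF assms(1)] so7_reflect[OF unit7_so7] unit7_entry)
    next
      case 3
      then have "unit7 i j $ k $ l = 0" by (intro unit7_eq_0) blast+
      with zero[OF 3] show ?thesis by simp
    qed
  qed
  then show ?thesis unfolding vec_eq_iff matrix_entry_simps by blast
qed

text \<open>The part of \<open>so7\<close> of degree at least k in the grading by w. For dominant w,
  k = 0 gives a standard parabolic subalgebra and k = 1 its nilradical, since degrees are
  integers.\<close>

definition filt :: "(7 \<Rightarrow> int) \<Rightarrow> int \<Rightarrow> mat7 set" where
  "filt w k = {X \<in> so7. \<forall>i j. w i - w j < k \<longrightarrow> X $ i $ j = 0}"

lemma filt_so7: "filt w k \<subseteq> so7"
  by (auto simp: filt_def)

lemma filt_nonzero: "X \<in> filt w k \<Longrightarrow> X $ i $ j \<noteq> 0 \<Longrightarrow> k \<le> w i - w j"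
  by (auto simp: filt_def not_less[symmetric])

lemma filt_subspace: "gl7.subspace (filt w k)"
  using so7_subspace by (auto simp: gl7.subspace_def filt_def)

lemma filt_commutator:
  assumes "X \<in> filt w k" "Y \<in> filt w l"
  shows "commutator X Y \<in> filt w (k + l)"
proof -
  have "(A ** B) $ i $ j = 0" if "A \<in> filt w a" "B \<in> filt w b" "w i - w j < a + b" for A B a b i j
  proof -
    have "A $ i $ m * B $ m $ j = 0" for m
      using filt_nonzero[OF that(1), of i m] filt_nonzero[OF that(2), of m j] that(3) by force
    then show ?thesis by (simp add: matrix_matrix_mult_def sum.neutral)
  qed
  from this[OF assms] this[OF assms(2,1)] show ?thesis
    using assms so7_commutator by (auto simp: filt_def commutator_def add.commute)
qed

lemma filt_subalgebra: "gl7.subalgebra (filt w 0)"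
  using filt_subspace filt_commutator[of _ w 0 _ 0] by (auto simp: gl7.subalgebra_def)

lemma filt_eq_0:
  assumes "\<And>i j. w i - w j < k"
  shows "filt w k = {0}"
  using assms gl7.subspace_0[OF filt_subspace] by (auto simp: filt_def vec_eq_iff)

lemma unit7_filt:
  assumes "k \<le> wt x y z i - wt x y z j"
  shows "unit7 i j \<in> filt (wt x y z) k"
proof -
  have "unit7 i j $ a $ b = 0" if "wt x y z a - wt x y z b < k" for a b
    using that assms by (intro unit7_eq_0) (simp_all add: not_less, auto)
  then show ?thesis by (simp add: filt_def unit7_so7)
qed

lemma unit7_filt_iff:
  assumes "j \<noteq> 6 - i"
  shows "unit7 i j \<in> filt (wt x y z) k \<longleftrightarrow> k \<le> wt x y z i - wt x y z j"
  using filt_nonzero[of "unit7 i j"] unit7_filt unit7_entry[OF assms] by force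

text \<open>Only d has to lie in the ideal: one bracket moves y into I, and each further one
  descends a step of the lower central series. This first bracket accounts for the exponent
  \<open>Suc n\<close> in the proof.\<close>

lemma (in complex_lie_algebra) nilpotent_ideal_ad_nilpotent:
  assumes "ideal I S" "nilpotent I" "d \<in> I" "y \<in> S"
  shows "\<exists>n. (br d ^^ n) y = 0"
proof -
  have anti: "br d y = - br y d"
  proof -
    have "br (d + y) (d + y) = br d d + br d y + (br y d + br y y)"
      by (simp only: br_add_left br_add_right ac_simps)
    then have "br d y + br y d = 0" by (simp add: br_self)
    then show ?thesis by (simp add: eq_neg_iff_add_eq_0)
  qed
  have "br d y \<in> I"
    using assms anti by (simp add: ideal_def subspace_neg)
  then have "(br d ^^ Suc n) y \<in> lower_central I n" for n
  proof (induction n)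
    case (Suc n)
    then show ?case using assms(3) by (auto intro: span_base)
  qed simp
  with assms(2) show ?thesis unfolding nilpotent_def by (metis singletonD)
qed

text \<open>With the nilradical defined as a span, an upper bound needs only one nilpotent ideal at
  a time; nilpotency of a sum of ideals never has to be shown.\<close>

lemma (in complex_lie_algebra) nilradical_subset:
  assumes "subspace N" "\<And>I. ideal I S \<Longrightarrow> nilpotent I \<Longrightarrow> I \<subseteq> N"
  shows "nilradical S \<subseteq> N"
  unfolding nilradical_def using assms by (intro span_minimal) auto

lemma (in complex_lie_algebra) nilpotent_ideal_subset_nilradical:
  "ideal I S \<Longrightarrow> nilpotent I \<Longrightarrow> I \<subseteq> nilradical S"
  unfolding nilradical_def using span_superset by fastforce

section \<open>The nilradical of a standard parabolic subalgebra\<close>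

lemma funpow_commutator_diagonal:
  assumes "\<And>i j. i \<noteq> j \<Longrightarrow> D $ i $ j = 0"
  shows "(commutator D ^^ n) Y $ i $ j = (D $ i $ i - D $ j $ j) ^ n * Y $ i $ j"
  by (induction n) (simp_all add: commutator_diagonal[OF assms])

lemma borel_subset_filt:
  assumes "x \<ge> y" "y \<ge> z" "z \<ge> 0"
  shows "borel \<subseteq> filt (wt x y z) 0"
proof
  fix X assume X: "X \<in> borel"
  then have "X $ i $ j = 0" if "wt x y z i < wt x y z j" for i j
    using wt_antimono[OF assms, of i j] that by (force simp: borel_def)
  with X show "X \<in> filt (wt x y z) 0" by (auto simp: filt_def borel_def)
qed

lemma cartan_subset_borel: "cartan \<subseteq> borel"
  by (auto simp: cartan_def borel_def)

lemma commutator_swap: "commutator Y X = - commutator X Y"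
  by (simp add: commutator_def)

lemma eq_reflect_iff: "(i :: 7) = 6 - i \<longleftrightarrow> i = 3"
proof -
  have "\<forall>i::7. i = 6 - i \<longleftrightarrow> i = 3" unfolding forall_7 by simp
  then show ?thesis by blast
qed

text \<open>Degrees add under the bracket, so the n-th term of the lower central series starts in
  degree 1 + n, while no entry has degree above 2x.\<close>

lemma nilpotent_filt:
  assumes "x \<ge> y" "y \<ge> z" "z \<ge> 0"
  shows "gl7.ideal (filt (wt x y z) 1) (filt (wt x y z) 0)" "gl7.nilpotent (filt (wt x y z) 1)"
proof -
  let ?w = "wt x y z"
  show "gl7.ideal (filt ?w 1) (filt ?w 0)"
    unfolding gl7.ideal_def using filt_commutator[of _ ?w 0 _ 1] filt_subspace
    by (auto simp: filt_def)
  have sub: "gl7.lower_central (filt ?w 1) n \<subseteq> filt ?w (1 + int n)" for n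
  proof (induction n)
    case (Suc n)
    have "commutator X Y \<in> filt ?w (1 + int (Suc n))"
      if "X \<in> filt ?w 1" "Y \<in> gl7.lower_central (filt ?w 1) n" for X Y
      using filt_commutator[OF that(1), of Y "1 + int n"] that(2) Suc by (simp add: algebra_simps subset_iff)
    then show ?case
      unfolding gl7.lower_central.simps by (intro gl7.span_minimal filt_subspace) auto
  qed simp
  have zero: "0 \<in> gl7.lower_central (filt ?w 1) n" for n
    by (cases n) (auto simp: gl7.span_zero gl7.subspace_0[OF filt_subspace])
  have bound: "\<forall>i j. ?w i - ?w j < 1 + int (nat (2 * x))"
    unfolding forall_7 wt_simps using assms by simp
  then have "filt ?w (1 + int (nat (2 * x))) = {0}" by (intro filt_eq_0) blast
  with sub[of "nat (2 * x)"] zero[of "nat (2 * x)"] show "gl7.nilpotent (filt ?w 1)"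
    unfolding gl7.nilpotent_def by blast
qed

text \<open>Degree 0 has to be excluded. The diagonal part of an element of I lies in I and is
  ad-nilpotent, hence zero; an off-diagonal entry of degree 0 is carried to the diagonal by the
  opposite root vector.\<close>

lemma nilpotent_ideal_filt:
  assumes xyz: "x \<ge> y" "y \<ge> z" "z \<ge> 0"
    and I: "gl7.ideal I (filt (wt x y z) 0)" "gl7.nilpotent I"
  shows "I \<subseteq> filt (wt x y z) 1"
proof -
  let ?w = "wt x y z"
  have sub: "gl7.subspace I" "I \<subseteq> filt ?w 0"
    and br: "\<And>X Y. X \<in> filt ?w 0 \<Longrightarrow> Y \<in> I \<Longrightarrow> commutator X Y \<in> I"
    using I(1) by (auto simp: gl7.ideal_def)
  have br': "commutator Y X \<in> I" if "X \<in> filt ?w 0" "Y \<in> I" for X Y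
    using gl7.subspace_neg[OF sub(1) br[OF that]] commutator_swap[of Y X] by simp
  have borel: "borel \<subseteq> filt ?w 0" by (rule borel_subset_filt[OF xyz])
  have diag: "X $ i $ i = 0" if X: "X \<in> I" for X i
  proof (cases "i = 3")
    case True
    have "X \<in> so7" using X sub(2) filt_so7 by blast
    from so7_antidiagonal[OF this, of 3] True show ?thesis by simp
  next
    case False
    define D :: mat7 where "D = (\<chi> k l. if generic k - generic l = 0 then X $ k $ l else 0)"
    have "dg generic \<in> filt ?w 0" using dg_cartan cartan_subset_borel borel by blast
    then have "D \<in> I"
      unfolding D_def by (intro isotypic_component sub br X) auto
    have D: "D $ k $ l = (if k = l then X $ k $ l else 0)" for k l
      by (simp add: D_def generic_inj)
    have eq: "D $ k $ k = D $ l $ l" if Y: "Y \<in> filt ?w 0" "Y $ k $ l \<noteq> 0" for Y k l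
    proof -
      obtain n where "(commutator D ^^ n) Y = 0"
        using gl7.nilpotent_ideal_ad_nilpotent[OF I \<open>D \<in> I\<close> Y(1)] by blast
      then have "(D $ k $ k - D $ l $ l) ^ n * Y $ k $ l = 0"
        using funpow_commutator_diagonal[of D n Y k l] D by simp
      with Y show ?thesis by simp
    qed
    \<comment> \<open>The middle diagonal entry is 0 throughout \<open>so7\<close>, and one of the
      root vectors at (i, 3) and (3, i) always lies in the parabolic subalgebra.\<close>
    have "D $ i $ i = D $ 3 $ 3"
    proof (cases "i < 3")
      case True
      with wt_antimono[OF xyz, of i 3] have "unit7 i 3 \<in> filt ?w 0" by (intro unit7_filt) simp
      moreover have "unit7 i 3 $ i $ 3 = 1" using False by (intro unit7_entry) (auto simp: eq_diff_eq)
      ultimately show ?thesis using eq by force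
    next
      case False
      with wt_antimono[OF xyz, of 3 i] have "unit7 3 i \<in> filt ?w 0" by (intro unit7_filt) simp
      moreover have "unit7 3 i $ 3 $ i = 1" using \<open>i \<noteq> 3\<close> by (intro unit7_entry) auto
      ultimately have "D $ 3 $ 3 = D $ i $ i" using eq by force
      then show ?thesis by simp
    qed
    moreover have "X \<in> so7" using X sub(2) filt_so7 by blast
    ultimately show ?thesis using so7_antidiagonal[of X 3] by (simp add: D)
  qed
  show ?thesis
  proof
    fix X assume X: "X \<in> I"
    then have so7: "X \<in> so7" using sub(2) filt_so7 by blast
    have "X $ i $ j = 0" if "?w i - ?w j < 1" for i j
    proof (cases "?w i = ?w j \<and> i \<noteq> j \<and> j \<noteq> 6 - i")
      case False
      have "X $ i $ j = 0" if "?w i \<noteq> ?w j"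
        using filt_nonzero[of X ?w 0 i j] X sub(2) that \<open>?w i - ?w j < 1\<close> by force
      with False show ?thesis using diag[OF X] so7_antidiagonal[OF so7] by auto
    next
      case True
      then have "commutator X (unit7 j i) \<in> I"
        using X by (intro br' unit7_filt) simp_all
      \<comment> \<open>For \<open>i = 3\<close> the two contributions to the diagonal entry at i
        cancel, and the one at j decides.\<close>
      from diag[OF this, of i] diag[OF this, of j] show ?thesis
        using True eq_reflect_iff[of i] eq_reflect_iff[of j] unfolding commutator_unit7
        by (cases "i = 3") (auto split: if_splits)
    qed
    with so7 show "X \<in> filt ?w 1" by (auto simp: filt_def)
  qed
qed

lemma nilradical_filt:
  assumes "x \<ge> y" "y \<ge> z" "z \<ge> 0"
  shows "gl7.nilradical (filt (wt x y z) 0) = filt (wt x y z) 1"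
  using gl7.nilradical_subset[OF filt_subspace nilpotent_ideal_filt[OF assms]]
    gl7.nilpotent_ideal_subset_nilradical[OF nilpotent_filt[OF assms]] by blast

section \<open>The parabolic subalgebras containing the Borel subalgebra\<close>

text \<open>The combination of the fundamental coweights (1,0,0), (1,1,0), (1,1,1) with the marks as
  coefficients.\<close>

fun marks_wt :: "nat \<times> nat \<times> nat \<Rightarrow> 7 \<Rightarrow> int" where
  "marks_wt (a1, a2, a3) = wt (int a1 + int a2 + int a3) (int a2 + int a3) (int a3)"

abbreviation standard_parabolic :: "nat \<times> nat \<times> nat \<Rightarrow> mat7 set" where
  "standard_parabolic a \<equiv> filt (marks_wt a) 0"

lemma nilradical_standard_parabolic:
  "gl7.nilradical (standard_parabolic a) = filt (marks_wt a) 1"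
  by (cases a) (simp add: nilradical_filt)

lemma standard_parabolic_mem: "standard_parabolic a \<in> parabolics"
  by (cases a) (simp add: parabolics_def filt_subalgebra filt_so7 borel_subset_filt)

text \<open>A triple (j, a, b) records that the root vector of the j-th simple root sits at the
  entry (a, b). The case j = 3 rests on the zero in the middle of the diagonal.\<close>

lemma simple_root_cartan:
  assumes "h \<in> cartan" "(j, a, b) \<in> {(1, 0, 1), (2, 1, 2), (3, 2, 3)}"
  shows "\<eta> j h = h $ a $ a - h $ b $ b"
proof -
  have "h $ 3 $ 3 = 0" using so7_antidiagonal[of h 3] assms(1) by (simp add: cartan_def)
  with assms(2) show ?thesis by (auto simp: simple_root_def)
qed

lemma simple_root_vector:
  assumes "(j, a, b) \<in> {(1, 0, 1), (2, 1, 2), (3, 2, 3)}"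
    and "X \<in> so7" "\<And>h. h \<in> cartan \<Longrightarrow> commutator h X = mscale (\<eta> j h) X"
  shows "X = mscale (X $ a $ b) (unit7 a b)"
proof (rule weight_vector_unit7)
  show "commutator (dg generic) X = mscale (of_int (generic a - generic b)) X"
    using assms(3)[OF dg_cartan] simple_root_cartan[OF dg_cartan assms(1)] by (simp add: dg_def)
  show "a \<noteq> b" using assms(1) by auto
qed (rule assms(2))

lemma simple_root_vector_neg:
  assumes "(j, a, b) \<in> {(1, 0, 1), (2, 1, 2), (3, 2, 3)}"
    and "X \<in> so7" "\<And>h. h \<in> cartan \<Longrightarrow> commutator h X = mscale (- \<eta> j h) X"
  shows "X = mscale (X $ b $ a) (unit7 b a)"
proof (rule weight_vector_unit7)
  show "commutator (dg generic) X = mscale (of_int (generic b - generic a)) X"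
    using assms(3)[OF dg_cartan] simple_root_cartan[OF dg_cartan assms(1)]
    by (simp add: dg_def gl7.scale_minus_left[symmetric] del: gl7.scale_minus_left)
  show "b \<noteq> a" using assms(1) by auto
qed (rule assms(2))

text \<open>One-dimensional root spaces turn the existence of a weight vector into membership of one
  explicit matrix.\<close>

lemma simple_root_weight_iff:
  assumes "(j, a, b) \<in> {(1, 0, 1), (2, 1, 2), (3, 2, 3)}" "V \<subseteq> so7" "gl7.subspace V"
  shows "gl7.weight cartan V (\<eta> j) \<longleftrightarrow> unit7 a b \<in> V"
proof
  assume "gl7.weight cartan V (\<eta> j)"
  then obtain X where X: "X \<in> V" "X \<noteq> 0" "\<And>h. h \<in> cartan \<Longrightarrow> commutator h X = mscale (\<eta> j h) X"
    by (auto simp: gl7.weight_def)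
  with assms(2) have eq: "X = mscale (X $ a $ b) (unit7 a b)"
    by (intro simple_root_vector[OF assms(1)]) auto
  with X(2) have "X $ a $ b \<noteq> 0" by (metis gl7.scale_zero_left)
  have "mscale (1 / X $ a $ b) X = unit7 a b"
    by (subst eq) (simp add: \<open>X $ a $ b \<noteq> 0\<close>)
  with X(1) show "unit7 a b \<in> V" by (metis assms(3) gl7.subspace_scale)
next
  assume "unit7 a b \<in> V"
  moreover have "unit7 a b $ a $ b = 1"
    using assms(1) by (intro unit7_entry) auto
  then have "unit7 a b \<noteq> 0" by force
  ultimately show "gl7.weight cartan V (\<eta> j)"
    unfolding gl7.weight_def
    using simple_root_cartan[OF _ assms(1)] by (auto simp: commutator_cartan_unit7)
qed

text \<open>Negating the weights gives the opposite parabolic subalgebra, so the intersection is the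
  part of degree exactly 0.\<close>

lemma standard_levi_part:
  assumes "x \<ge> y" "y \<ge> z" "z \<ge> 0"
  shows "gl7.levi_part cartan (filt (wt x y z) 0) (filt (wt x y z) 0 \<inter> filt (wt (-x) (-y) (-z)) 0)"
    (is "gl7.levi_part cartan ?p (?p \<inter> ?q)")
proof -
  have neg: "wt (-x) (-y) (-z) i = - wt x y z i" for i by (simp add: wt_def)
  have "gl7.subalgebra (?p \<inter> ?q)"
    using filt_subalgebra[of "wt x y z"] filt_subalgebra[of "wt (-x) (-y) (-z)"]
    by (auto simp: gl7.subalgebra_def intro: gl7.subspace_inter)
  moreover have "cartan \<subseteq> ?p \<inter> ?q"
    by (auto simp: cartan_def filt_def neg) force+
  moreover have "(?p \<inter> ?q) \<inter> filt (wt x y z) 1 = {0}"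
  proof -
    have "X = 0" if X: "X \<in> ?q" "X \<in> filt (wt x y z) 1" for X
    proof -
      have "X $ i $ j = 0" for i j
        using filt_nonzero[OF X(1), of i j] filt_nonzero[OF X(2), of i j] by (force simp: neg)
      then show ?thesis by (simp add: vec_eq_iff)
    qed
    then show ?thesis using gl7.subspace_0[OF filt_subspace] by blast
  qed
  moreover have "?p = {X + Y | X Y. X \<in> ?p \<inter> ?q \<and> Y \<in> filt (wt x y z) 1}"
  proof -
    have "\<exists>X Y. Z = X + Y \<and> X \<in> ?p \<inter> ?q \<and> Y \<in> filt (wt x y z) 1" if Z: "Z \<in> ?p" for Z
    proof -
      let ?V = "{X + Y | X Y. X \<in> ?p \<inter> ?q \<and> Y \<in> filt (wt x y z) 1}"
      have V: "gl7.subspace ?V"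
        by (intro gl7.subspace_sums gl7.subspace_inter filt_subspace)
      have units: "unit7 i j \<in> ?V" if "Z $ i $ j \<noteq> 0" for i j
      proof (cases "wt x y z i = wt x y z j")
        case True
        then have "unit7 i j \<in> ?p \<inter> ?q" by (auto intro!: unit7_filt simp: neg)
        moreover have "unit7 i j = unit7 i j + 0" by simp
        ultimately show ?thesis using gl7.subspace_0[OF filt_subspace] by blast
      next
        case False
        with filt_nonzero[OF Z that] have "unit7 i j \<in> filt (wt x y z) 1" by (auto intro!: unit7_filt)
        moreover have "0 \<in> ?p \<inter> ?q" by (simp add: gl7.subspace_0 filt_subspace)
        moreover have "unit7 i j = 0 + unit7 i j" by simp
        ultimately show ?thesis by blast
      qed
      have "Z \<in> so7" using Z filt_so7 by blast
      from so7_mem_by_units[OF V this units] show ?thesis by blast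
    qed
    moreover have "X + Y \<in> ?p" if "X \<in> ?p" "Y \<in> filt (wt x y z) 1" for X Y
    proof -
      have "Y \<in> ?p" using that(2) by (auto simp: filt_def)
      with that(1) show ?thesis by (intro gl7.subspace_add filt_subspace)
    qed
    ultimately show ?thesis by blast
  qed
  ultimately show ?thesis
    unfolding gl7.levi_part_def nilradical_filt[OF assms] by blast
qed

text \<open>The mark condition quantifies over all Levi parts. One direction uses the standard one;
  for the other, an arbitrary Levi part meets the nilradical trivially, so it cannot contain a root
  vector of positive degree.\<close>

lemma levi_mark_iff:
  assumes "(j, a, b) \<in> {(1, 0, 1), (2, 1, 2), (3, 2, 3)}" "x \<ge> y" "y \<ge> z" "z \<ge> 0"
  shows "(\<exists>l. gl7.levi_part cartan (filt (wt x y z) 0) l \<and> gl7.weight cartan l (\<eta> j))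
    \<longleftrightarrow> wt x y z a \<le> wt x y z b" (is "?L \<longleftrightarrow> ?R")
proof
  assume ?R
  let ?l = "filt (wt x y z) 0 \<inter> filt (wt (-x) (-y) (-z)) 0"
  have le: "wt x y z b \<le> wt x y z a"
    using assms by auto
  have neg: "wt (-x) (-y) (-z) i = - wt x y z i" for i by (simp add: wt_def)
  have "unit7 a b \<in> ?l" using \<open>?R\<close> le by (auto intro!: unit7_filt simp: neg)
  then have "gl7.weight cartan ?l (\<eta> j)"
    by (subst simple_root_weight_iff[OF assms(1)])
      (use filt_so7 in \<open>auto intro: gl7.subspace_inter filt_subspace\<close>)
  with standard_levi_part[OF assms(2-4)] show ?L by blast
next
  assume ?L
  then obtain l where l: "gl7.subalgebra l" "l \<inter> filt (wt x y z) 1 = {0}"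
      "filt (wt x y z) 0 = {X + Y | X Y. X \<in> l \<and> Y \<in> filt (wt x y z) 1}"
      "gl7.weight cartan l (\<eta> j)"
    by (auto simp: gl7.levi_part_def nilradical_filt[OF assms(2-4)])
  have "l \<subseteq> filt (wt x y z) 0"
  proof
    fix X assume "X \<in> l"
    moreover have "X = X + 0" by simp
    ultimately show "X \<in> filt (wt x y z) 0"
      unfolding l(3) using gl7.subspace_0[OF filt_subspace] by blast
  qed
  then have "l \<subseteq> so7" using filt_so7 by blast
  with l have unit: "unit7 a b \<in> l"
    using simple_root_weight_iff[OF assms(1), of l] by (auto simp: gl7.subalgebra_def)
  show ?R
  proof (rule ccontr)
    assume "\<not> ?R"
    then have "unit7 a b \<in> filt (wt x y z) 1" by (intro unit7_filt) simp
    with unit l(2) have "unit7 a b = 0" by blast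
    moreover have "unit7 a b $ a $ b = 1"
      using assms(1) by (intro unit7_entry) auto
    ultimately show False by simp
  qed
qed

text \<open>Distinct marks are told apart by the standard parabolic subalgebras, which yields both
  uniqueness in the definite description \<open>parabolic\<close> and its injectivity.\<close>

lemma parabolic_marks_standard:
  assumes "a \<in> {0,1} \<times> {0,1} \<times> {0,1}" "b \<in> {0,1} \<times> {0,1} \<times> {0,1}"
  shows "parabolic_marks a (standard_parabolic b) \<longleftrightarrow> a = b"
proof -
  obtain a1 a2 a3 where a: "a = (a1, a2, a3)" by (cases a) auto
  obtain b1 b2 b3 where b: "b = (b1, b2, b3)" by (cases b) auto
  have nil: "gl7.weight cartan (filt (marks_wt b) 1) (\<eta> 1) \<longleftrightarrow> b1 \<ge> 1"
    "gl7.weight cartan (filt (marks_wt b) 1) (\<eta> 2) \<longleftrightarrow> b2 \<ge> 1"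
    "gl7.weight cartan (filt (marks_wt b) 1) (\<eta> 3) \<longleftrightarrow> b3 \<ge> 1"
    using simple_root_weight_iff[of 1 0 1 "filt (marks_wt b) 1"]
      simple_root_weight_iff[of 2 1 2 "filt (marks_wt b) 1"]
      simple_root_weight_iff[of 3 2 3 "filt (marks_wt b) 1"]
    by (simp_all add: b filt_so7 filt_subspace unit7_filt_iff)
  have levi: "(\<exists>l. gl7.levi_part cartan (standard_parabolic b) l \<and> gl7.weight cartan l (\<eta> 1)) \<longleftrightarrow> b1 = 0"
    "(\<exists>l. gl7.levi_part cartan (standard_parabolic b) l \<and> gl7.weight cartan l (\<eta> 2)) \<longleftrightarrow> b2 = 0"
    "(\<exists>l. gl7.levi_part cartan (standard_parabolic b) l \<and> gl7.weight cartan l (\<eta> 3)) \<longleftrightarrow> b3 = 0"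
    using levi_mark_iff[of 1 0 1 "int b2 + int b3" "int b1 + int b2 + int b3" "int b3"]
      levi_mark_iff[of 2 1 2 "int b2 + int b3" "int b1 + int b2 + int b3" "int b3"]
      levi_mark_iff[of 3 2 3 "int b2 + int b3" "int b1 + int b2 + int b3" "int b3"]
    by (simp_all add: b)
  have "parabolic_marks a (standard_parabolic b) \<longleftrightarrow>
      (a1 = 1 \<longrightarrow> b1 \<ge> 1) \<and> (a1 = 0 \<longrightarrow> b1 = 0) \<and> (a2 = 1 \<longrightarrow> b2 \<ge> 1) \<and> (a2 = 0 \<longrightarrow> b2 = 0)
    \<and> (a3 = 1 \<longrightarrow> b3 \<ge> 1) \<and> (a3 = 0 \<longrightarrow> b3 = 0)"
    unfolding a by (simp add: nilradical_standard_parabolic nil levi)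
  moreover have "a1 = 0 \<or> a1 = 1" "a2 = 0 \<or> a2 = 1" "a3 = 0 \<or> a3 = 1"
    "b1 = 0 \<or> b1 = 1" "b2 = 0 \<or> b2 = 1" "b3 = 0 \<or> b3 = 1"
    using assms by (auto simp: a b)
  then have "a = b \<longleftrightarrow>
      (a1 = 1 \<longrightarrow> b1 \<ge> 1) \<and> (a1 = 0 \<longrightarrow> b1 = 0) \<and> (a2 = 1 \<longrightarrow> b2 \<ge> 1) \<and> (a2 = 0 \<longrightarrow> b2 = 0)
    \<and> (a3 = 1 \<longrightarrow> b3 \<ge> 1) \<and> (a3 = 0 \<longrightarrow> b3 = 0)"
    by (elim disjE) (simp_all add: a b)
  ultimately show ?thesis by blast
qed

text \<open>A subalgebra stable under \<open>dg generic\<close> is determined by the root vectors it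
  contains. All positive ones are there, and the negative ones are governed by the negative simple
  ones.\<close>

lemma parabolic_eq_standard:
  assumes p: "p \<in> parabolics"
  shows "\<exists>a \<in> {0,1} \<times> {0,1} \<times> {0,1}. p = standard_parabolic a"
proof -
  define M where "M i j \<longleftrightarrow> unit7 i j \<in> p" for i j
  have sub: "gl7.subspace p" "borel \<subseteq> p" "p \<subseteq> so7"
    and br: "\<And>X Y. X \<in> p \<Longrightarrow> Y \<in> p \<Longrightarrow> commutator X Y \<in> p"
    using p by (auto simp: parabolics_def gl7.subalgebra_def)
  have unit: "unit7 i j \<in> p" if X: "X \<in> p" "X $ i $ j \<noteq> 0" "i \<noteq> j" for X i j
  proof -
    define Y :: mat7 where "Y = (\<chi> k l. if generic k - generic l = generic i - generic j then X $ k $ l else 0)"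
    have "dg generic \<in> p" using dg_cartan cartan_subset_borel sub by blast
    then have "Y \<in> p" unfolding Y_def by (intro isotypic_component sub br X)
    have Yij: "Y $ i $ j = X $ i $ j" by (simp add: Y_def)
    have "commutator (dg generic) Y = mscale (of_int (generic i - generic j)) Y"
      by (simp add: vec_eq_iff commutator_dg Y_def del: of_int_diff)
    then have eq: "Y = mscale (Y $ i $ j) (unit7 i j)"
      using \<open>Y \<in> p\<close> sub X by (intro weight_vector_unit7) auto
    have "mscale (1 / Y $ i $ j) Y = unit7 i j"
      by (subst eq) (simp add: Yij X)
    with \<open>Y \<in> p\<close> show ?thesis by (metis sub(1) gl7.subspace_scale)
  qed
  \<comment> \<open>The side conditions rule out root vectors that are zero and cancellation in the
    bracket.\<close>
  have trans: "M i k" if M: "M i j" "M j k" and ne: "i \<noteq> j \<and> j \<noteq> k \<and> i \<noteq> k \<and> j \<noteq> 6 - i \<and> k \<noteq> 6 - j \<and> k \<noteq> 6 - i"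
    for i j k
  proof -
    have "commutator (unit7 i j) (unit7 j k) \<in> p" using M unfolding M_def by (rule br)
    moreover have "i \<noteq> 6 - k" using ne by auto
    with ne have "commutator (unit7 i j) (unit7 j k) $ i $ k = 1"
      unfolding commutator_unit7 by (simp add: unit7_entry)
    then have "commutator (unit7 i j) (unit7 j k) $ i $ k \<noteq> 0" by simp
    moreover have "i \<noteq> k" using ne by blast
    ultimately show ?thesis unfolding M_def by (rule unit)
  qed
  have upper: "M i j" if "i \<le> j" for i j
  proof -
    have "unit7 i j $ k $ l = 0" if "l < k" for k l
    proof (rule unit7_eq_0)
      show "\<not> (k = i \<and> l = j)" using that \<open>i \<le> j\<close> by auto
      show "\<not> (k = 6 - j \<and> l = 6 - i)"
      proof
        assume "k = 6 - j \<and> l = 6 - i"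
        with that have "j < i" by (simp add: less_iff_wt)
        with \<open>i \<le> j\<close> show False by simp
      qed
    qed
    with sub(2) show ?thesis by (auto simp: M_def borel_def unit7_so7)
  qed
  have reflect: "M (6 - j) (6 - i) \<longleftrightarrow> M i j" for i j
    using gl7.subspace_neg[OF sub(1), of "unit7 i j"] gl7.subspace_neg[OF sub(1), of "- unit7 i j"]
    unfolding M_def unit7_reflect by auto
  \<comment> \<open>A mark is 0 when the negative simple root vector belongs to p, so that the
    simple root is in the Levi part.\<close>
  define a where "a = (if M 1 0 then 0 else 1 :: nat, if M 2 1 then 0 else 1 :: nat, if M 3 2 then 0 else 1 :: nat)"
  have up: "M 0 1" "M 1 2" "M 2 3" "M 3 4" "M 4 5"
    by (auto intro!: upper simp: less_iff_wt le_less)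
  \<comment> \<open>Mirror images reduce the entries below the diagonal to nine, one for each
    negative root.\<close>
  have refl: "M 4 3 = M 3 2" "M 5 4 = M 2 1" "M 6 5 = M 1 0" "M 6 4 = M 2 0" "M 5 3 = M 3 1"
    "M 6 3 = M 3 0" "M 5 2 = M 4 1" "M 6 2 = M 4 0" "M 6 1 = M 5 0"
    using reflect[of 2 3] reflect[of 1 2] reflect[of 0 1] reflect[of 0 2] reflect[of 1 3]
      reflect[of 0 3] reflect[of 1 4] reflect[of 0 4] reflect[of 0 5] by simp_all
  \<comment> \<open>Brackets with positive root vectors bring a negative root in p down to its
    simple constituents; \<open>lower\<close> then rebuilds it from them.\<close>
  have raise: "M 2 0 \<Longrightarrow> M 1 0" "M 2 0 \<Longrightarrow> M 2 1" "M 3 1 \<Longrightarrow> M 2 1" "M 3 1 \<Longrightarrow> M 3 2"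
    "M 3 0 \<Longrightarrow> M 2 0" "M 3 0 \<Longrightarrow> M 3 1" "M 4 1 \<Longrightarrow> M 3 1" "M 4 0 \<Longrightarrow> M 3 0" "M 5 0 \<Longrightarrow> M 4 0"
    using trans[of 1 2 0] trans[of 2 0 1] trans[of 2 3 1] trans[of 3 1 2] trans[of 2 3 0]
      trans[of 3 0 1] trans[of 3 4 1] trans[of 3 4 0] trans[of 4 5 0] up by simp_all
  have lower: "M 2 1 \<Longrightarrow> M 1 0 \<Longrightarrow> M 2 0" "M 3 2 \<Longrightarrow> M 2 1 \<Longrightarrow> M 3 1" "M 3 2 \<Longrightarrow> M 2 0 \<Longrightarrow> M 3 0"
    "M 4 3 \<Longrightarrow> M 3 1 \<Longrightarrow> M 4 1" "M 4 3 \<Longrightarrow> M 3 0 \<Longrightarrow> M 4 0" "M 5 4 \<Longrightarrow> M 4 0 \<Longrightarrow> M 5 0"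
    using trans[of 2 1 0] trans[of 3 2 1] trans[of 3 2 0] trans[of 4 3 1] trans[of 4 3 0]
      trans[of 5 4 0] by simp_all
  have nonsimple: "M 2 0 \<longleftrightarrow> M 2 1 \<and> M 1 0" "M 3 1 \<longleftrightarrow> M 3 2 \<and> M 2 1"
    "M 3 0 \<longleftrightarrow> M 3 2 \<and> M 2 1 \<and> M 1 0" "M 4 1 \<longleftrightarrow> M 3 2 \<and> M 2 1"
    "M 4 0 \<longleftrightarrow> M 3 2 \<and> M 2 1 \<and> M 1 0" "M 5 0 \<longleftrightarrow> M 3 2 \<and> M 2 1 \<and> M 1 0"
    using raise lower refl(1,2) by blast+
  have key: "\<forall>i j. j < i \<longrightarrow> j \<noteq> 6 - i \<longrightarrow> (M i j \<longleftrightarrow> marks_wt a j \<le> marks_wt a i)"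
    unfolding forall_7 a_def marks_wt.simps wt_simps less_iff_wt
    by (simp add: refl nonsimple)
  have M_iff: "M i j \<longleftrightarrow> marks_wt a j \<le> marks_wt a i" if "j \<noteq> 6 - i" for i j
  proof (cases "j < i")
    case True
    with that key show ?thesis by blast
  next
    case False
    then have "marks_wt a j \<le> marks_wt a i"
      unfolding a_def marks_wt.simps by (intro wt_antimono) auto
    with False show ?thesis using upper[of i j] by simp
  qed
  have "p = standard_parabolic a"
  proof
    show "p \<subseteq> standard_parabolic a"
    proof
      fix X assume X: "X \<in> p"
      have "X $ i $ j = 0" if "marks_wt a i - marks_wt a j < 0" for i j
      proof (cases "j = 6 - i")
        case True
        with X sub show ?thesis by (auto simp: so7_antidiagonal)
      next
        case False
        with that have "\<not> M i j" by (simp add: M_iff)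
        moreover have "i \<noteq> j" using that by auto
        ultimately show ?thesis using unit[OF X] unfolding M_def by blast
      qed
      with X sub show "X \<in> standard_parabolic a" by (auto simp: filt_def)
    qed
    show "standard_parabolic a \<subseteq> p"
    proof
      fix X assume X: "X \<in> standard_parabolic a"
      then have so7: "X \<in> so7" using filt_so7 by blast
      show "X \<in> p"
      proof (rule so7_mem_by_units[OF sub(1) so7])
        fix i j assume nz: "X $ i $ j \<noteq> 0"
        then have "j \<noteq> 6 - i" using so7_antidiagonal[OF so7] by auto
        with filt_nonzero[OF X nz] show "unit7 i j \<in> p"
          using M_iff[of j i] by (simp add: M_def)
      qed
    qed
  qed
  moreover have "a \<in> {0,1} \<times> {0,1} \<times> {0,1}" by (auto simp: a_def)
  ultimately show ?thesis by blast
qed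

lemma parabolic_eq:
  assumes "a \<in> {0,1} \<times> {0,1} \<times> {0,1}"
  shows "parabolic a = standard_parabolic a"
  unfolding parabolic_def
proof (rule the_equality)
  show "standard_parabolic a \<in> parabolics \<and> parabolic_marks a (standard_parabolic a)"
    using standard_parabolic_mem parabolic_marks_standard[OF assms assms] by blast
  show "p = standard_parabolic a" if "p \<in> parabolics \<and> parabolic_marks a p" for p
    using parabolic_eq_standard[of p] parabolic_marks_standard[OF assms] that by blast
qed

lemma bij_betw_parabolic: "bij_betw parabolic ({0,1} \<times> {0,1} \<times> {0,1}) parabolics"
proof (rule bij_betwI')
  fix a b :: "nat \<times> nat \<times> nat"
  assume ab: "a \<in> {0,1} \<times> {0,1} \<times> {0,1}" "b \<in> {0,1} \<times> {0,1} \<times> {0,1}"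
  then show "parabolic a = parabolic b \<longleftrightarrow> a = b"
    using parabolic_marks_standard by (metis parabolic_eq)
next
  fix a :: "nat \<times> nat \<times> nat"
  assume "a \<in> {0,1} \<times> {0,1} \<times> {0,1}"
  then show "parabolic a \<in> parabolics" by (simp only: parabolic_eq standard_parabolic_mem)
next
  fix p assume "p \<in> parabolics"
  from parabolic_eq_standard[OF this] show "\<exists>a\<in>{0,1} \<times> {0,1} \<times> {0,1}. p = parabolic a"
    by (metis parabolic_eq)
qed

section \<open>Ideals of subalgebras of Lie G2\<close>

lemma dg_diagonal: "dg (wt x y z) $ i $ i = of_int (wt x y z i)"
  by (simp add: dg_def)

text \<open>Coroots up to normalization: for the short root j = 3 the result is half of the
  coroot.\<close>

lemma diagonal_coroot:
  assumes "(j, a, b) \<in> {(1 :: int, 0, 1), (2, 1, 2), (3, 2, 3)}"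
  shows "commutator (unit7 a b) (unit7 b a) = dg (wt (if j = 1 then 1 else 0)
    (if j = 1 then - 1 else if j = 2 then 1 else 0) (if j = 2 then - 1 else if j = 3 then 1 else 0))"
proof -
  have "\<forall>k l. commutator (unit7 0 1) (unit7 1 0) $ k $ l = dg (wt 1 (- 1) 0) $ k $ l"
    "\<forall>k l. commutator (unit7 1 2) (unit7 2 1) $ k $ l = dg (wt 0 1 (- 1)) $ k $ l"
    "\<forall>k l. commutator (unit7 2 3) (unit7 3 2) $ k $ l = dg (wt 0 0 1) $ k $ l"
    unfolding commutator_unit7 forall_7 unfolding unit7_def dg_def by simp_all
  with assms show ?thesis by (auto simp: vec_eq_iff)
qed

text \<open>\<open>V\<close> stands for the image in \<open>so7\<close> of a nilpotent ideal of a subalgebra of Lie \<open>G2\<close> containing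
  the Borel subalgebra. The constants 4, 3, 1 are a regular element of the Cartan subalgebra of
  Lie \<open>G2\<close>.\<close>

locale G2_borel_module =
  fixes V :: "mat7 set" and c1 c2 c3 :: complex
  assumes V: "gl7.subspace V" "V \<subseteq> so7"
    and c: "c1 \<noteq> 0" "c2 \<noteq> 0" "c3 \<noteq> 0"
    and torus: "\<And>X. X \<in> V \<Longrightarrow> commutator (dg (wt 4 3 1)) X \<in> V"
    and raise_short: "\<And>X. X \<in> V \<Longrightarrow> commutator X (mscale c1 (unit7 0 1) + mscale c3 (unit7 2 3)) \<in> V"
    and raise_long: "\<And>X. X \<in> V \<Longrightarrow> commutator X (mscale c2 (unit7 1 2)) \<in> V"
    and nil_short: "\<And>X. X \<in> V \<Longrightarrow>
          \<exists>n. (commutator X ^^ n) (mscale c1 (unit7 0 1) + mscale c3 (unit7 2 3)) = 0"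
    and nil_long: "\<And>X. X \<in> V \<Longrightarrow> \<exists>n. (commutator X ^^ n) (mscale c2 (unit7 1 2)) = 0"
begin

text \<open>The diagonal part acts nilpotently on both raising elements, whose nonzero entries
  involve all three simple roots of so(7). All simple roots vanish on it, so it is zero.\<close>

lemma diagonal_zero:
  assumes X: "X \<in> V"
  shows "X $ i $ i = 0"
proof -
  \<comment> \<open>The numbers 4, 3, 1, 0, -1, -3, -4 are distinct, so degree 0 is exactly the
    diagonal. Coincidences such as 4 - 3 = 1 - 0 concern other degrees only.\<close>
  define D :: mat7 where "D = (\<chi> k l. if wt 4 3 1 k - wt 4 3 1 l = 0 then X $ k $ l else 0)"
  have DV: "D \<in> V" unfolding D_def by (rule isotypic_component[OF V(1) torus X])
  have inj: "\<forall>k l. wt 4 3 1 k = wt 4 3 1 l \<longleftrightarrow> k = l"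
    unfolding forall_7 by simp
  have D: "D $ k $ l = (if k = l then X $ k $ k else 0)" for k l
    using inj by (simp add: D_def)
  have eq: "X $ k $ k = X $ l $ l" if "(commutator D ^^ n) Y = 0" "Y $ k $ l \<noteq> 0" for n Y k l
    using funpow_commutator_diagonal[of D n Y k l] that D by simp
  from nil_short[OF DV] obtain n where
    n: "(commutator D ^^ n) (mscale c1 (unit7 0 1) + mscale c3 (unit7 2 3)) = 0" by blast
  from nil_long[OF DV] obtain m where m: "(commutator D ^^ m) (mscale c2 (unit7 1 2)) = 0" by blast
  have "X $ 0 $ 0 = X $ 1 $ 1" "X $ 2 $ 2 = X $ 3 $ 3" "X $ 1 $ 1 = X $ 2 $ 2"
    using eq[OF n, of 0 1] eq[OF n, of 2 3] eq[OF m, of 1 2] c by (simp_all add: unit7_def)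
  moreover have X7: "X \<in> so7" using X V by blast
  from so7_antidiagonal[OF this, of 3] have "X $ 3 $ 3 = 0" by simp
  ultimately have "\<forall>i. X $ i $ i = 0"
    using so7_reflect[OF X7, of 0 0] so7_reflect[OF X7, of 1 1] so7_reflect[OF X7, of 2 2]
    unfolding forall_7 by simp
  then show ?thesis by blast
qed

lemma raise_short_entry:
  "commutator X (mscale c1 (unit7 0 1) + mscale c3 (unit7 2 3)) $ i $ j =
    c1 * commutator X (unit7 0 1) $ i $ j + c3 * commutator X (unit7 2 3) $ i $ j"
  by (simp add: gl7.br_add_right gl7.br_scale_right)

lemma raise_long_entry:
  "commutator X (mscale c2 (unit7 1 2)) $ i $ j = c2 * commutator X (unit7 1 2) $ i $ j"
  by (simp add: gl7.br_scale_right)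

text \<open>Bracketing with the raising operators moves every entry below the diagonal towards the
  diagonal, where it has to vanish.\<close>

lemma lower_zero:
  assumes X: "X \<in> V" and "j \<le> i"
  shows "X $ i $ j = 0"
proof -
  have short: "c1 * commutator X (unit7 0 1) $ i $ j + c3 * commutator X (unit7 2 3) $ i $ j = 0"
    if "X \<in> V" "\<And>Y. Y \<in> V \<Longrightarrow> Y $ i $ j = 0" for X i j
    using that(2)[OF raise_short[OF that(1)]] by (simp add: raise_short_entry)
  have long: "commutator X (unit7 1 2) $ i $ j = 0"
    if "X \<in> V" "\<And>Y. Y \<in> V \<Longrightarrow> Y $ i $ j = 0" for X i j
    using that(2)[OF raise_long[OF that(1)]] c by (simp add: raise_long_entry)
  have e10: "X $ 1 $ 0 = 0" if "X \<in> V" for X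
    using short[OF that diagonal_zero, of 0] c by (simp add: commutator_unit7)
  have e32: "X $ 3 $ 2 = 0" if "X \<in> V" for X
    using short[OF that diagonal_zero, of 2] c by (simp add: commutator_unit7)
  have e21: "X $ 2 $ 1 = 0" if "X \<in> V" for X
    using long[OF that diagonal_zero, of 1] by (simp add: commutator_unit7)
  have e20: "X $ 2 $ 0 = 0" if "X \<in> V" for X
    using long[OF that e10] by (simp add: commutator_unit7)
  have e31: "X $ 3 $ 1 = 0" if "X \<in> V" for X
    using long[OF that e32] by (simp add: commutator_unit7)
  have e30: "X $ 3 $ 0 = 0" if "X \<in> V" for X
    using short[OF that e20] c by (simp add: commutator_unit7)
  \<comment> \<open>Both summands of the raising element contribute here, so the entry (3, 0) must
    already be known to vanish.\<close>
  have e41: "X $ 4 $ 1 = 0" if "X \<in> V" for X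
    using short[OF that e31] c e30[OF that] by (simp add: commutator_unit7)
  have e40: "X $ 4 $ 0 = 0" if "X \<in> V" for X
    using short[OF that e30] c by (simp add: commutator_unit7)
  have e50: "X $ 5 $ 0 = 0" if "X \<in> V" for X
    using long[OF that e40] by (simp add: commutator_unit7)
  have X7: "X \<in> so7" using X V by blast
  have "\<forall>i j. j < i \<longrightarrow> X $ i $ j = 0"
    using so7_reflect[OF X7, of 0 1] so7_reflect[OF X7, of 1 2] so7_reflect[OF X7, of 2 3]
      so7_reflect[OF X7, of 0 2] so7_reflect[OF X7, of 1 3] so7_reflect[OF X7, of 0 3]
      so7_reflect[OF X7, of 1 4] so7_reflect[OF X7, of 0 4] so7_reflect[OF X7, of 0 5]
      so7_antidiagonal[OF X7, of 6] so7_antidiagonal[OF X7, of 5] so7_antidiagonal[OF X7, of 4]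
    unfolding forall_7 less_iff_wt
    by (simp add: e10[OF X] e21[OF X] e32[OF X] e20[OF X] e31[OF X] e30[OF X] e41[OF X] e40[OF X] e50[OF X])
  with diagonal_zero[OF X, of i] assms(2) show ?thesis by (cases "i = j") auto
qed

text \<open>The lowering element carries the two entries onto the diagonal, where V vanishes. This
  applies when the short simple root is in the Levi part of \<open>bar p\<close>.\<close>

lemma lower_short_zero:
  assumes "\<And>X. X \<in> V \<Longrightarrow> commutator X (mscale d1 (unit7 1 0) + mscale d3 (unit7 3 2)) \<in> V"
    and "d1 \<noteq> 0" "d3 \<noteq> 0" "X \<in> V"
  shows "X $ 0 $ 1 = 0" "X $ 2 $ 3 = 0"
  using diagonal_zero[OF assms(1)[OF assms(4)], of 0] diagonal_zero[OF assms(1)[OF assms(4)], of 2] assms(2,3)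
  by (simp_all add: gl7.br_add_right gl7.br_scale_right commutator_unit7)

lemma lower_long_zero:
  assumes "\<And>X. X \<in> V \<Longrightarrow> commutator X (mscale d2 (unit7 2 1)) \<in> V" "d2 \<noteq> 0" "X \<in> V"
  shows "X $ 1 $ 2 = 0"
  using diagonal_zero[OF assms(1)[OF assms(3)], of 1] assms(2)
  by (simp_all add: gl7.br_add_right gl7.br_scale_right commutator_unit7)

text \<open>The case in which both lowering elements act. The entries above the diagonal are moved
  down to it, as in \<open>lower_zero\<close> with the roles of raising and lowering
  exchanged.\<close>

lemma trivial:
  assumes v1: "\<And>X. X \<in> V \<Longrightarrow> commutator X (mscale d1 (unit7 1 0) + mscale d3 (unit7 3 2)) \<in> V"
    and v2: "\<And>X. X \<in> V \<Longrightarrow> commutator X (mscale d2 (unit7 2 1)) \<in> V"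
    and d: "d1 \<noteq> 0" "d2 \<noteq> 0" "d3 \<noteq> 0" and X: "X \<in> V"
  shows "X = 0"
proof -
  have short: "d1 * commutator X (unit7 1 0) $ i $ j + d3 * commutator X (unit7 3 2) $ i $ j = 0"
    if "X \<in> V" "\<And>Y. Y \<in> V \<Longrightarrow> Y $ i $ j = 0" for X i j
    using that(2)[OF v1[OF that(1)]] by (simp add: gl7.br_add_right gl7.br_scale_right)
  have long: "commutator X (unit7 2 1) $ i $ j = 0"
    if "X \<in> V" "\<And>Y. Y \<in> V \<Longrightarrow> Y $ i $ j = 0" for X i j
    using that(2)[OF v2[OF that(1)]] d by (simp add: gl7.br_scale_right)
  have e: "X $ 0 $ 1 = 0" "X $ 2 $ 3 = 0" "X $ 1 $ 2 = 0" if "X \<in> V" for X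
    using lower_short_zero[of d1 d3 X] lower_long_zero[of d2 X] v1 v2 d that by blast+
  have e02: "X $ 0 $ 2 = 0" if "X \<in> V" for X
    using long[OF that e(1)] by (simp add: commutator_unit7)
  have e13: "X $ 1 $ 3 = 0" if "X \<in> V" for X
    using long[OF that e(2)] by (simp add: commutator_unit7)
  have e03: "X $ 0 $ 3 = 0" if "X \<in> V" for X
    using short[OF that e02] d by (simp add: commutator_unit7)
  have e14: "X $ 1 $ 4 = 0" if "X \<in> V" for X
    using short[OF that e13] d e03[OF that] by (simp add: commutator_unit7)
  have e04: "X $ 0 $ 4 = 0" if "X \<in> V" for X
    using short[OF that e03] d by (simp add: commutator_unit7)
  have e05: "X $ 0 $ 5 = 0" if "X \<in> V" for X
    using long[OF that e04] by (simp add: commutator_unit7)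
  have X7: "X \<in> so7" using X V by blast
  have upper: "\<forall>i j. i < j \<longrightarrow> X $ i $ j = 0"
    using so7_reflect[OF X7, of 1 0] so7_reflect[OF X7, of 2 1] so7_reflect[OF X7, of 3 2]
      so7_reflect[OF X7, of 2 0] so7_reflect[OF X7, of 3 1] so7_reflect[OF X7, of 3 0]
      so7_reflect[OF X7, of 4 1] so7_reflect[OF X7, of 4 0] so7_reflect[OF X7, of 5 0]
      so7_antidiagonal[OF X7, of 0] so7_antidiagonal[OF X7, of 1] so7_antidiagonal[OF X7, of 2]
    unfolding forall_7 less_iff_wt
    by (simp add: e[OF X] e02[OF X] e13[OF X] e03[OF X] e14[OF X] e04[OF X] e05[OF X])
  have "X $ i $ j = 0" for i j
    using lower_zero[OF X, of j i] upper by (cases "j \<le> i") auto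
  then show ?thesis by (simp add: vec_eq_iff)
qed

end

section \<open>The image of the Cartan subalgebra of Lie G2, and compatibility\<close>

context G2_in_so7
begin

lemma iota_linear_simps:
  "\<iota> (x + y) = \<iota> x + \<iota> y" "\<iota> (scale c x) = mscale c (\<iota> x)" "\<iota> 0 = 0" "\<iota> (- x) = - \<iota> x"
proof -
  interpret L: Vector_Spaces.linear scale mscale \<iota> by (rule linear_iota)
  show "\<iota> (x + y) = \<iota> x + \<iota> y" "\<iota> (scale c x) = mscale c (\<iota> x)" "\<iota> 0 = 0" "\<iota> (- x) = - \<iota> x"
    by (rule L.add L.scale L.zero L.neg)+
qed

section \<open>The Chevalley generators of so(7) as multiples of root vectors\<close>

lemma generated_so7: "gl7.generated_subalgebra (g ` {1, 2, 3, -1, -2, -3}) = so7"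
  using chevalley_so7 by (simp add: gl7.chevalley_generators_def insert_commute)

lemma generators_subset_so7: "g ` {1, 2, 3, -1, -2, -3} \<subseteq> so7"
proof -
  have "g ` {1, 2, 3, -1, -2, -3} \<subseteq> gl7.generated_subalgebra (g ` {1, 2, 3, -1, -2, -3})"
    unfolding gl7.generated_subalgebra_def by blast
  then show ?thesis unfolding generated_so7 .
qed

lemma generator_unit7:
  assumes "(j, a, b) \<in> {(1, 0, 1), (2, 1, 2), (3, 2, 3)}"
  shows "g j = mscale (g j $ a $ b) (unit7 a b)" "g (- j) = mscale (g (- j) $ b $ a) (unit7 b a)"
proof -
  have j: "j \<in> {1, 2, 3}" using assms by auto
  then have "g j \<in> so7" "g (- j) \<in> so7" using generators_subset_so7 by auto
  then show "g j = mscale (g j $ a $ b) (unit7 a b)" "g (- j) = mscale (g (- j) $ b $ a) (unit7 b a)"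
    using root_vectors_so7[OF j] simple_root_vector[OF assms] simple_root_vector_neg[OF assms] by blast+
qed

text \<open>If \<open>g j\<close> vanished, all generators would lie in the opposite parabolic subalgebra that omits
  the simple root \<open>\<eta> j\<close>.\<close>

lemma generator_nonzero:
  assumes "(j, a, b) \<in> {(1, 0, 1), (2, 1, 2), (3, 2, 3)}"
  shows "g j $ a $ b \<noteq> 0"
proof
  assume "g j $ a $ b = 0"
  with generator_unit7(1)[OF assms] have gj: "g j = 0" by simp
  obtain x y z where w: "wt x y z a - wt x y z b < 0"
    and le: "\<And>i c d. (i, c, d) \<in> {(1 :: int, 0 :: 7, 1 :: 7), (2, 1, 2), (3, 2, 3)} \<Longrightarrow> wt x y z c \<le> wt x y z d"
    and eq: "\<And>i c d. (i, c, d) \<in> {(1 :: int, 0 :: 7, 1 :: 7), (2, 1, 2), (3, 2, 3)} \<Longrightarrow> i \<noteq> j \<Longrightarrow> wt x y z c = wt x y z d"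
  proof -
    \<comment> \<open>The weights solve for the diagonal element on which the j-th simple root is -1
      and the other two are 0.\<close>
    define m :: "int \<Rightarrow> int" where "m i = (if i = j then - 1 else 0)" for i
    show thesis
      by (rule that[of "m 1 + m 2 + m 3" "m 2 + m 3" "m 3"]) (use assms in \<open>auto simp: m_def\<close>)
  qed
  let ?q = "filt (wt x y z) 0"
  have mem: "g i \<in> ?q \<and> g (- i) \<in> ?q" if i: "(i, c, d) \<in> {(1 :: int, 0 :: 7, 1 :: 7), (2, 1, 2), (3, 2, 3)}" for i c d
  proof
    have "unit7 d c \<in> ?q" using le[OF i] by (intro unit7_filt) simp
    then show "g (- i) \<in> ?q"
      by (subst generator_unit7(2)[OF i]) (intro gl7.subspace_scale filt_subspace)
    show "g i \<in> ?q"
    proof (cases "i = j")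
      case True
      then show ?thesis by (simp add: gj gl7.subspace_0 filt_subspace)
    next
      case False
      have "unit7 c d \<in> ?q" using eq[OF i False] by (intro unit7_filt) simp
      then show ?thesis
        by (subst generator_unit7(1)[OF i]) (intro gl7.subspace_scale filt_subspace)
    qed
  qed
  have "g ` {1, 2, 3, -1, -2, -3} \<subseteq> ?q" using mem[of 1 0 1] mem[of 2 1 2] mem[of 3 2 3] by auto
  then have "so7 \<subseteq> ?q"
    unfolding generated_so7[symmetric] gl7.generated_subalgebra_def using filt_subalgebra by blast
  then have "unit7 a b \<in> ?q" using unit7_so7 by blast
  moreover have "b \<noteq> 6 - a" using assms by auto
  ultimately show False using w by (simp add: unit7_filt_iff)
qed

text \<open>The scalars c and d of \<open>g j\<close> and \<open>g (- j)\<close> are not fixed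
  separately, but the relation with diagonal Cartan entry 2 fixes their product. The number k in the
  proof is the value of the root on the unnormalized coroot.\<close>

lemma coroot:
  assumes "(j, a, b) \<in> {(1, 0, 1), (2, 1, 2), (3, 2, 3)}"
  shows "commutator (g j) (g (- j)) = dg (wt (if j = 1 then 1 else 0)
    (if j = 1 then - 1 else if j = 2 then 1 else 0) (if j = 2 then - 1 else if j = 3 then 2 else 0))"
    (is ?coroot)
    and "g (- j) $ b $ a \<noteq> 0"
proof -
  define c where "c = g j $ a $ b"
  define d where "d = g (- j) $ b $ a"
  define k :: int where "k = (if j = 3 then 1 else 2)"
  have cd: "g j = mscale c (unit7 a b)" "g (- j) = mscale d (unit7 b a)"
    using generator_unit7[OF assms] by (simp_all only: c_def d_def)
  define w where "w = wt (if j = 1 then 1 else 0)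
    (if j = 1 then - 1 else if j = 2 then 1 else 0) (if j = 2 then - 1 else if j = 3 then 1 else 0)"
  have K: "commutator (unit7 a b) (unit7 b a) = dg w"
    unfolding w_def by (rule diagonal_coroot[OF assms])
  have cK: "commutator (g j) (g (- j)) = mscale (c * d) (dg w)"
    by (simp add: cd gl7.br_scale_left gl7.br_scale_right K)
  have "j \<in> {1, 2, 3}" using assms by auto
  then have "commutator (commutator (g j) (g (- j))) (g j) = mscale 2 (g j)"
    using chevalley_so7 unfolding gl7.chevalley_generators_def cartan_matrix_B3_def by fastforce
  then have "mscale (c * d) (commutator (dg w) (g j)) $ a $ b = mscale 2 (g j) $ a $ b"
    by (simp only: cK gl7.br_scale_left)
  then have "c * d * of_int (w a - w b) * c = 2 * c"
    by (simp add: commutator_dg c_def[symmetric] mult_ac del: of_int_diff)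
  moreover have "w a - w b = k" using assms by (auto simp: w_def k_def)
  moreover have "c \<noteq> 0" using generator_nonzero[OF assms] by (simp add: c_def)
  ultimately have cdk: "c * d * of_int k = 2" by simp
  then have "d \<noteq> 0" by auto
  then show "g (- j) $ b $ a \<noteq> 0" by (simp add: d_def)
  have "c * d = (if j = 3 then 2 else 1)" using cdk by (auto simp: k_def)
  with assms show ?coroot
    unfolding cK by (auto simp: w_def dg_def wt_def vec_eq_iff)
qed

lemma iota_coroot_bar:
  "\<iota> (br (gbar 1) (gbar (- 1))) = dg (wt 1 (- 1) 2)"
  "\<iota> (br (gbar 2) (gbar (- 2))) = dg (wt 0 1 (- 1))"
proof -
  have "commutator (g 1) (g (- 3)) = 0" "commutator (g 3) (g (- 1)) = 0"
    using chevalley_so7 unfolding gl7.chevalley_generators_def by fastforce+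
  then have "\<iota> (br (gbar 1) (gbar (- 1))) = dg (wt 1 (- 1) 0) + dg (wt 0 0 2)"
    using coroot(1)[of 1 0 1] coroot(1)[of 3 2 3]
    by (simp add: bracket_iota iota_1 gl7.br_add_left gl7.br_add_right)
  also have "\<dots> = dg (wt 1 (- 1) 2)" by (simp add: dg_def wt_def vec_eq_iff)
  finally show "\<iota> (br (gbar 1) (gbar (- 1))) = dg (wt 1 (- 1) 2)" .
  show "\<iota> (br (gbar 2) (gbar (- 2))) = dg (wt 0 1 (- 1))"
    using coroot(1)[of 2 1 2] by (simp add: bracket_iota iota_2)
qed

text \<open>The element with value m on the short and n on the long simple root. The coefficients
  come from the inverse of the Cartan matrix of type G2, which is integral because its determinant
  is 1.\<close>

lemma cartan_bar_integral:
  "\<exists>h \<in> cartan_bar. \<iota> h = dg (wt (2 * m + n) (m + n) m)"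
proof -
  let ?h = "scale (of_int (2 * m + n)) (br (gbar 1) (gbar (- 1))) + scale (of_int (3 * m + 2 * n)) (br (gbar 2) (gbar (- 2)))"
  have "?h \<in> cartan_bar"
    unfolding cartan_bar_def by (intro span_add span_scale span_base) auto
  moreover have "\<iota> ?h = dg (wt (2 * m + n) (m + n) m)"
    by (auto simp: iota_linear_simps iota_coroot_bar vec_eq_iff dg_def wt_def algebra_simps)
  ultimately show ?thesis by blast
qed

lemma iota_cartan_bar:
  assumes "h \<in> cartan_bar"
  shows "\<iota> h \<in> cartan" "\<iota> h $ 0 $ 0 - \<iota> h $ 1 $ 1 = \<iota> h $ 2 $ 2"
proof -
  let ?S = "{h. \<iota> h \<in> cartan \<and> \<iota> h $ 0 $ 0 - \<iota> h $ 1 $ 1 = \<iota> h $ 2 $ 2}"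
  have "gl7.subspace cartan"
    using so7_subspace by (auto simp: cartan_def gl7.subspace_def)
  then have "subspace ?S"
    by (auto simp: subspace_def gl7.subspace_def iota_linear_simps algebra_simps)
  moreover have "br (gbar j) (gbar (- j)) \<in> ?S" if "j \<in> {1, 2}" for j
    using that dg_cartan by (auto simp: iota_coroot_bar) (auto simp: dg_def)
  ultimately have "cartan_bar \<subseteq> ?S"
    unfolding cartan_bar_def by (intro span_minimal) auto
  with assms show "\<iota> h \<in> cartan" "\<iota> h $ 0 $ 0 - \<iota> h $ 1 $ 1 = \<iota> h $ 2 $ 2" by auto
qed

text \<open>When the outer marks agree, the weights \<open>marks_wt a\<close> themselves come from
  \<open>cartan_bar\<close>, so the grading that defines the parabolic subalgebra already is of the
  required kind.\<close>

lemma compatible_standard: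
  assumes "fst a = snd (snd a)"
  shows "compatible (standard_parabolic a)"
proof -
  obtain m n where a: "a = (m, n, m)" using assms by (cases a) auto
  define w where "w = wt (2 * int m + int n) (int m + int n) (int m)"
  have aw: "marks_wt a = w" by (simp add: a w_def add.commute)
  obtain h where h: "h \<in> cartan_bar" "\<iota> h = dg w"
    using cartan_bar_integral unfolding w_def by blast
  have unit: "unit7 i j \<in> gl7.eigenspace so7 (dg w) (of_int (w i - w j))" for i j
    using commutator_cartan_unit7[of "dg w" i j] dg_cartan
    by (simp add: gl7.eigenspace_def unit7_so7 w_def dg_diagonal)
  have eigen: "X $ i $ j = 0 \<or> c = of_int (w i - w j)"
    if "X \<in> gl7.eigenspace so7 (dg w) c" for X c i j
  proof -
    have "commutator (dg w) X $ i $ j = mscale c X $ i $ j" using that by (simp add: gl7.eigenspace_def)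
    then show ?thesis by (auto simp: commutator_dg simp del: of_int_diff)
  qed
  have "gl7.ad_diagonalizable so7 (dg w)"
    unfolding gl7.ad_diagonalizable_def
  proof
    show "gl7.span (\<Union>c. gl7.eigenspace so7 (dg w) c) \<subseteq> so7"
      by (intro gl7.span_minimal so7_subspace) (auto simp: gl7.eigenspace_def)
    show "so7 \<subseteq> gl7.span (\<Union>c. gl7.eigenspace so7 (dg w) c)"
      using unit by (blast intro: so7_mem_by_units gl7.span_base gl7.subspace_span)
  qed
  moreover have "c \<in> \<real>" if "gl7.eigenspace so7 (dg w) c \<noteq> {0}" for c
  proof -
    have "0 \<in> gl7.eigenspace so7 (dg w) c"
      by (simp add: gl7.eigenspace_def gl7.subspace_0 so7_subspace commutator_def)
    with that obtain X where X: "X \<in> gl7.eigenspace so7 (dg w) c" "X \<noteq> 0" by blast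
    then obtain i j where "X $ i $ j \<noteq> 0" by (auto simp: vec_eq_iff)
    with eigen[OF X(1)] show ?thesis by (metis Reals_of_int)
  qed
  moreover have "standard_parabolic a = gl7.span (\<Union>c\<in>{c \<in> \<real>. Re c \<ge> 0}. gl7.eigenspace so7 (dg w) c)"
    (is "_ = gl7.span ?E")
  proof
    show "gl7.span ?E \<subseteq> standard_parabolic a"
    proof (intro gl7.span_minimal filt_subspace subsetI)
      fix X assume "X \<in> ?E"
      then obtain c where c: "Re c \<ge> 0" "X \<in> gl7.eigenspace so7 (dg w) c" by blast
      then have "X $ i $ j = 0" if "w i - w j < 0" for i j
        using eigen[OF c(2), of i j] that by fastforce
      with c(2) show "X \<in> standard_parabolic a" by (auto simp: filt_def aw gl7.eigenspace_def)
    qed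
    show "standard_parabolic a \<subseteq> gl7.span ?E"
    proof
      fix X assume X: "X \<in> standard_parabolic a"
      then have "X \<in> so7" using filt_so7 by blast
      then show "X \<in> gl7.span ?E"
      proof (rule so7_mem_by_units[OF gl7.subspace_span])
        fix i j assume "X $ i $ j \<noteq> 0"
        with filt_nonzero[OF X] have "0 \<le> w i - w j" by (simp add: aw)
        then have "of_int (w i - w j) \<in> {c \<in> \<real>. Re c \<ge> 0}" by simp
        with unit show "unit7 i j \<in> gl7.span ?E" by (blast intro: gl7.span_base)
      qed
    qed
  qed
  ultimately show ?thesis unfolding compatible_def h(2)[symmetric] using h(1) by blast
qed

lemma compatible_standard_imp:
  assumes "compatible (standard_parabolic (a1, a2, a3))"
  shows "a1 = 0 \<longleftrightarrow> a3 = 0"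
proof -
  obtain h where h: "h \<in> cartan_bar"
    and p: "standard_parabolic (a1, a2, a3) = gl7.span (\<Union>c\<in>{c \<in> \<real>. Re c \<ge> 0}. gl7.eigenspace so7 (\<iota> h) c)"
    and real: "\<And>c. gl7.eigenspace so7 (\<iota> h) c \<noteq> {0} \<Longrightarrow> c \<in> \<real>"
    using assms unfolding compatible_def by blast
  let ?E = "\<Union>c\<in>{c \<in> \<real>. Re c \<ge> 0}. gl7.eigenspace so7 (\<iota> h) c"
  note H = iota_cartan_bar[OF h]
  \<comment> \<open>Reality of the eigenvalues places the root vector in a summand; conversely, an
    entry whose eigenvalue has negative real part vanishes on the whole span.\<close>
  have iff: "unit7 i j \<in> gl7.span ?E \<longleftrightarrow> Re (\<iota> h $ i $ i - \<iota> h $ j $ j) \<ge> 0" if "j \<noteq> 6 - i" for i j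
  proof
    have eig: "unit7 i j \<in> gl7.eigenspace so7 (\<iota> h) (\<iota> h $ i $ i - \<iota> h $ j $ j)"
      using commutator_cartan_unit7[OF H(1)] by (simp add: gl7.eigenspace_def unit7_so7)
    have "unit7 i j \<noteq> 0" using unit7_entry[OF that] by force
    with eig real have "\<iota> h $ i $ i - \<iota> h $ j $ j \<in> \<real>" by blast
    moreover assume "Re (\<iota> h $ i $ i - \<iota> h $ j $ j) \<ge> 0"
    ultimately have "unit7 i j \<in> ?E" using eig by blast
    then show "unit7 i j \<in> gl7.span ?E" by (rule gl7.span_base)
  next
    assume mem: "unit7 i j \<in> gl7.span ?E"
    show "Re (\<iota> h $ i $ i - \<iota> h $ j $ j) \<ge> 0"
    proof (rule ccontr)
      assume neg: "\<not> ?thesis"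
      have "gl7.subspace {X. X $ i $ j = 0}" by (simp add: gl7.subspace_def)
      moreover have "?E \<subseteq> {X. X $ i $ j = 0}"
      proof
        fix X assume "X \<in> ?E"
        then obtain c where c: "Re c \<ge> 0" "X \<in> gl7.eigenspace so7 (\<iota> h) c" by blast
        then have "commutator (\<iota> h) X $ i $ j = c * X $ i $ j" by (simp add: gl7.eigenspace_def)
        then have "(\<iota> h $ i $ i - \<iota> h $ j $ j) * X $ i $ j = c * X $ i $ j"
          by (simp only: commutator_cartan[OF H(1)])
        with c(1) neg show "X \<in> {X. X $ i $ j = 0}" by auto
      qed
      ultimately have "unit7 i j $ i $ j = 0" using mem gl7.span_minimal by blast
      with unit7_entry[OF that] show False by simp
    qed
  qed
  have "\<iota> h $ 3 $ 3 = 0" using so7_antidiagonal[of "\<iota> h" 3] H(1) by (simp add: cartan_def)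
  then have "\<iota> h $ 1 $ 1 - \<iota> h $ 0 $ 0 = \<iota> h $ 3 $ 3 - \<iota> h $ 2 $ 2" using H(2) by (simp add: algebra_simps)
  then have "unit7 1 0 \<in> gl7.span ?E \<longleftrightarrow> unit7 3 2 \<in> gl7.span ?E"
    using iff[of 0 1] iff[of 2 3] by simp
  then show ?thesis unfolding p[symmetric] by (simp add: unit7_filt_iff)
qed
end

section \<open>Weak compatibility\<close>

lemma eigenvalue_dg:
  assumes "commutator (dg w) X = mscale c X" "X \<noteq> 0"
  shows "\<exists>i j. X $ i $ j \<noteq> 0 \<and> c = of_int (w i - w j)"
proof -
  obtain i j where ij: "X $ i $ j \<noteq> 0" using assms(2) by (auto simp: vec_eq_iff)
  have "of_int (w i - w j) * X $ i $ j = c * X $ i $ j"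
    using assms(1) by (metis commutator_dg matrix_entry_simps(2))
  with ij show ?thesis by (intro exI[of _ i] exI[of _ j]) (simp del: of_int_diff)
qed

context G2_in_so7
begin

lemma bar_iff: "x \<in> bar p \<longleftrightarrow> \<iota> x \<in> p"
  by (auto simp: bar_def)

lemma iota_funpow: "\<iota> ((br d ^^ n) y) = (commutator (\<iota> d) ^^ n) (\<iota> y)"
  by (induction n) (simp_all add: bracket_iota)

text \<open>Nilpotent ideals of \<open>bar p\<close> satisfy the assumptions of
  \<open>G2_borel_module\<close>, which confines them strictly above the diagonal; lowering elements
  that lie in \<open>bar p\<close> remove the remaining entries of degree 0.\<close>

lemma nilpotent_ideal_bar:
  fixes a1 a2 a3 :: nat
  defines "w \<equiv> wt (2 * int (max a1 a3) + int a2) (int (max a1 a3) + int a2) (int (max a1 a3))"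
  assumes I: "ideal I (bar (standard_parabolic (a1, a2, a3)))" "nilpotent I"
  shows "\<iota> ` I \<subseteq> filt w 1"
proof -
  define m where "m = max a1 a3"
  have w: "w = wt (2 * int m + int a2) (int m + int a2) (int m)" by (simp add: w_def m_def)
  let ?p = "standard_parabolic (a1, a2, a3)"
  let ?V = "\<iota> ` I"
  have sub: "subspace I" "I \<subseteq> bar ?p" and br: "\<And>x y. x \<in> bar ?p \<Longrightarrow> y \<in> I \<Longrightarrow> br x y \<in> I"
    using I(1) by (auto simp: ideal_def)
  have V: "gl7.subspace ?V"
    using sub(1) unfolding gl7.subspace_def subspace_def
    by (auto simp: iota_linear_simps[symmetric])
  have brV: "commutator (\<iota> y) X \<in> ?V" if "\<iota> y \<in> ?p" "X \<in> ?V" for X y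
    using br[of y] that by (auto simp: bracket_iota[symmetric] bar_iff)
  have brV': "commutator X (\<iota> y) \<in> ?V" if "\<iota> y \<in> ?p" "X \<in> ?V" for X y
    using gl7.subspace_neg[OF V brV[OF that]] commutator_swap[of X "\<iota> y"] by simp
  have nil: "\<exists>n. (commutator X ^^ n) (\<iota> y) = 0" if y: "\<iota> y \<in> ?p" and X: "X \<in> ?V" for X y
  proof -
    obtain d where d: "d \<in> I" "X = \<iota> d" using X by blast
    from nilpotent_ideal_ad_nilpotent[OF I d(1)] y obtain n where "(br d ^^ n) y = 0"
      by (auto simp: bar_iff)
    then show ?thesis using iota_funpow[of n d y] by (auto simp: d(2) iota_linear_simps)
  qed
  define c where "c j = g j $ of_int (j - 1) $ of_int j" for j
  define d where "d j = g (- j) $ of_int j $ of_int (j - 1)" for j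
  have c: "c 1 \<noteq> 0" "c 2 \<noteq> 0" "c 3 \<noteq> 0"
    using generator_nonzero[of 1 0 1] generator_nonzero[of 2 1 2] generator_nonzero[of 3 2 3]
    by (simp_all add: c_def)
  have d: "d 1 \<noteq> 0" "d 2 \<noteq> 0" "d 3 \<noteq> 0"
    using coroot(2)[of 1 0 1] coroot(2)[of 2 1 2] coroot(2)[of 3 2 3]
    by (simp_all add: d_def)
  have pos: "\<iota> (gbar 1) = mscale (c 1) (unit7 0 1) + mscale (c 3) (unit7 2 3)"
    "\<iota> (gbar 2) = mscale (c 2) (unit7 1 2)"
    using generator_unit7(1)[of 1 0 1] generator_unit7(1)[of 2 1 2] generator_unit7(1)[of 3 2 3]
    by (simp_all add: c_def iota_1 iota_2)
  have neg: "\<iota> (gbar (- 1)) = mscale (d 1) (unit7 1 0) + mscale (d 3) (unit7 3 2)"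
    "\<iota> (gbar (- 2)) = mscale (d 2) (unit7 2 1)"
    using generator_unit7(2)[of 1 0 1] generator_unit7(2)[of 2 1 2] generator_unit7(2)[of 3 2 3]
    by (simp_all add: d_def iota_1 iota_2)
  have pos_p: "\<iota> (gbar 1) \<in> ?p" "\<iota> (gbar 2) \<in> ?p"
    unfolding pos marks_wt.simps
    by (auto intro!: gl7.subspace_add gl7.subspace_scale filt_subspace unit7_filt)
  have neg1_p: "\<iota> (gbar (- 1)) \<in> ?p" if "m = 0"
    using that unfolding m_def neg marks_wt.simps
    by (auto intro!: gl7.subspace_add gl7.subspace_scale filt_subspace unit7_filt)
  have neg2_p: "\<iota> (gbar (- 2)) \<in> ?p" if "a2 = 0"
    using that unfolding neg marks_wt.simps
    by (auto intro!: gl7.subspace_add gl7.subspace_scale filt_subspace unit7_filt)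
  obtain t where t: "\<iota> t = dg (wt 4 3 1)"
    using cartan_bar_integral[of 1 2] by auto
  have "borel \<subseteq> ?p" by (simp add: borel_subset_filt)
  then have t_p: "\<iota> t \<in> ?p" using dg_cartan cartan_subset_borel unfolding t by blast
  interpret G2_borel_module ?V "c 1" "c 2" "c 3"
  proof
    have "\<iota> x \<in> ?p" if "x \<in> I" for x using subsetD[OF sub(2) that] bar_iff by blast
    then show "?V \<subseteq> so7" using filt_so7 by blast
    show "commutator (dg (wt 4 3 1)) X \<in> ?V" if "X \<in> ?V" for X
      using brV[OF t_p that] by (simp add: t)
  qed (use V c brV'[OF pos_p(1)] brV'[OF pos_p(2)] nil[OF pos_p(1)] nil[OF pos_p(2)] in \<open>simp_all add: pos\<close>)
  show ?thesis
  proof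
    fix X assume X: "X \<in> ?V"
    then have X7: "X \<in> so7" using V(2) by blast
    have short: "X $ 0 $ 1 = 0 \<and> X $ 2 $ 3 = 0" if "m = 0"
      using brV'[OF neg1_p[OF that]] lower_short_zero[of "d 1" "d 3" X] d X unfolding neg by blast
    have long: "X $ 1 $ 2 = 0" if "a2 = 0"
      using brV'[OF neg2_p[OF that]] lower_long_zero[of "d 2" X] d X unfolding neg by blast
    have both: "X = 0" if "m = 0" "a2 = 0"
      using brV'[OF neg1_p[OF that(1)]] brV'[OF neg2_p[OF that(2)]]
        trivial[of "d 1" "d 3" "d 2" X] d X unfolding neg by blast
    have refl: "X $ 5 $ 6 = - X $ 0 $ 1" "X $ 3 $ 4 = - X $ 2 $ 3" "X $ 4 $ 5 = - X $ 1 $ 2" "X $ 2 $ 4 = 0"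
      using so7_reflect[OF X7, of 1 0] so7_reflect[OF X7, of 3 2] so7_reflect[OF X7, of 2 1]
        so7_antidiagonal[OF X7, of 2] by simp_all
    \<comment> \<open>Above the diagonal, degree 0 occurs only in the Levi part: for m = 0 < a2 at
      (0,1), (2,3), their mirror images and the antidiagonal entry (2,4); for a2 = 0 < m at (1,2)
      and its mirror image; for m, a2 > 0 nowhere.\<close>
    have upper: "\<forall>i j. i < j \<longrightarrow> w i = w j \<longrightarrow> X $ i $ j = 0"
    proof (cases "m = 0")
      case True
      show ?thesis
      proof (cases "a2 = 0")
        case False
        then show ?thesis
          unfolding w forall_7 less_iff_wt wt_simps True using short[OF True] by (simp add: refl)
      qed (simp add: both[OF True])
    next
      case False
      then have m: "int m > 0" by simp
      show ?thesis
      proof (cases "a2 = 0")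
        case True
        from m show ?thesis
          unfolding w forall_7 less_iff_wt wt_simps True using long[OF True]
          by (simp add: refl)
      next
        case False
        then have "int a2 > 0" by simp
        with m show ?thesis
          unfolding w forall_7 less_iff_wt wt_simps by simp
      qed
    qed
    have "X $ i $ j = 0" if "w i - w j < 1" for i j
    proof (cases "j \<le> i")
      case True
      then show ?thesis by (rule lower_zero[OF X])
    next
      case False
      then have "w j \<le> w i" unfolding w by (intro wt_antimono) auto
      with that upper False show ?thesis by auto
    qed
    with X7 show "X \<in> filt w 1" by (simp add: filt_def)
  qed
qed

lemma weakly_compatible_standard: "weakly_compatible (standard_parabolic a)"
proof -
  obtain a1 a2 a3 where a: "a = (a1, a2, a3)" by (cases a) auto
  define w where "w = wt (2 * int (max a1 a3) + int a2) (int (max a1 a3) + int a2) (int (max a1 a3))"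
  obtain h where h: "h \<in> cartan_bar" "\<iota> h = dg w"
    using cartan_bar_integral unfolding w_def by blast
  have h_cartan: "dg w \<in> cartan" by (simp add: w_def dg_cartan)
  have "\<gamma> (\<iota> h) \<in> \<rat>" if root: "gl7.root cartan so7 \<gamma>" for \<gamma>
  proof -
    obtain X where "X \<noteq> 0" "commutator (dg w) X = mscale (\<gamma> (dg w)) X"
      using root h_cartan by (auto simp: gl7.root_def gl7.weight_def)
    with eigenvalue_dg show ?thesis unfolding h(2) by (metis Rats_of_int)
  qed
  moreover have "\<alpha> h \<in> \<real> \<and> Re (\<alpha> h) > 0"
    if weight: "weight cartan_bar (nilradical (bar (standard_parabolic a))) \<alpha>" for \<alpha>
  proof -
    obtain x where x: "x \<in> nilradical (bar (standard_parabolic a))" "x \<noteq> 0" "br h x = scale (\<alpha> h) x"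
      using weight h(1) by (auto simp: weight_def)
    have "subspace (\<iota> -` filt w 1)"
      using filt_subspace[of w 1] by (auto simp: subspace_def gl7.subspace_def iota_linear_simps)
    then have "nilradical (bar (standard_parabolic a)) \<subseteq> \<iota> -` filt w 1"
      using nilpotent_ideal_bar[of _ a1 a2 a3] unfolding a w_def by (intro nilradical_subset) blast+
    with x(1) have x1: "\<iota> x \<in> filt w 1" by blast
    have "\<iota> x \<noteq> 0" using x(2) inj_iota iota_linear_simps(3) by (metis injD)
    moreover have "commutator (dg w) (\<iota> x) = mscale (\<alpha> h) (\<iota> x)"
      using x(3) by (metis bracket_iota h(2) iota_linear_simps(2))
    ultimately obtain i j where "\<iota> x $ i $ j \<noteq> 0" "\<alpha> h = of_int (w i - w j)"
      using eigenvalue_dg by blast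
    with filt_nonzero[OF x1, of i j] show ?thesis by (simp del: of_int_diff)
  qed
  moreover have "\<beta> (\<iota> h) \<in> \<real> \<and> Re (\<beta> (\<iota> h)) \<ge> 0"
    if weight: "gl7.weight cartan (gl7.nilradical (standard_parabolic a)) \<beta>" for \<beta>
  proof -
    obtain X where X: "X \<in> filt (marks_wt a) 1" "X \<noteq> 0" "commutator (dg w) X = mscale (\<beta> (dg w)) X"
      using weight h_cartan by (auto simp: gl7.weight_def nilradical_standard_parabolic)
    then obtain i j where ij: "X $ i $ j \<noteq> 0" "\<beta> (dg w) = of_int (w i - w j)"
      using eigenvalue_dg by blast
    \<comment> \<open>The nilradical of p lives strictly above the diagonal, where every dominant
      weight has nonnegative degree.\<close>
    have "marks_wt a j < marks_wt a i" using filt_nonzero[OF X(1) ij(1)] by simp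
    then have "\<not> j \<le> i"
      using wt_antimono[of "int a2 + int a3" "int a1 + int a2 + int a3" "int a3" j i] by (auto simp: a)
    then have "w j \<le> w i" unfolding w_def by (intro wt_antimono) auto
    with ij(2) show ?thesis by (simp add: h(2) del: of_int_diff)
  qed
  ultimately show ?thesis unfolding weakly_compatible_def using h(1) by blast
qed

end

theorem corollary5p3:
  fixes scale :: "complex \<Rightarrow> 'g::ab_group_add \<Rightarrow> 'g" and br :: "'g \<Rightarrow> 'g \<Rightarrow> 'g"
    and gbar :: "int \<Rightarrow> 'g" and g :: "int \<Rightarrow> mat7" and \<iota> :: "'g \<Rightarrow> mat7"
  assumes "G2_in_so7 scale br gbar g \<iota>"
  shows "bij_betw parabolic ({0,1} \<times> {0,1} \<times> {0,1}) parabolics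
    \<and> (\<forall>a \<in> {0,1} \<times> {0,1} \<times> {0,1}. parabolic_marks a (parabolic a))
    \<and> card parabolics = 8
    \<and> (\<forall>p \<in> parabolics. G2_in_so7.weakly_compatible scale br gbar \<iota> p)
    \<and> (\<forall>a \<in> {(1,0,1), (0,1,0), (1,1,1), (0,0,0)}.
         G2_in_so7.compatible scale br gbar \<iota> (parabolic a))
    \<and> (\<forall>a \<in> {0,1} \<times> {0,1} \<times> {0,1} - {(1,0,1), (0,1,0), (1,1,1), (0,0,0)}.
         \<not> G2_in_so7.compatible scale br gbar \<iota> (parabolic a))"
proof (intro conjI ballI)
  interpret G2_in_so7 scale br gbar g \<iota> by (rule assms)
  show "bij_betw parabolic ({0,1} \<times> {0,1} \<times> {0,1}) parabolics" by (rule bij_betw_parabolic)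
  then show "card parabolics = 8"
    by (auto simp: card_cartesian_product dest!: bij_betw_same_card)
  show "parabolic_marks a (parabolic a)" if "a \<in> {0,1} \<times> {0,1} \<times> {0,1}" for a
    unfolding parabolic_eq[OF that] parabolic_marks_standard[OF that that] ..
  show "weakly_compatible p" if "p \<in> parabolics" for p
    using parabolic_eq_standard[OF that] weakly_compatible_standard by blast
  show "compatible (parabolic a)" if "a \<in> {(1,0,1), (0,1,0), (1,1,1), (0,0,0)}" for a
  proof -
    have "parabolic a = standard_parabolic a" using that by (intro parabolic_eq) auto
    moreover have "fst a = snd (snd a)" using that by auto
    ultimately show ?thesis using compatible_standard by metis
  qed
  show "\<not> compatible (parabolic a)"
    if "a \<in> {0,1} \<times> {0,1} \<times> {0,1} - {(1,0,1), (0,1,0), (1,1,1), (0,0,0)}" for a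
  proof
    assume *: "compatible (parabolic a)"
    obtain a1 a2 a3 where a: "a = (a1, a2, a3)" by (cases a) auto
    have "parabolic a = standard_parabolic a" using that by (intro parabolic_eq) blast
    with * have "a1 = 0 \<longleftrightarrow> a3 = 0" using compatible_standard_imp unfolding a by metis
    with that show False by (auto simp: a)
  qed
qed

end
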